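(* Let $(\mathbf{Z}_n)_{n\ge 0}$ and $\mathbf{F}$ be as in the context, with a general strictly increasing $f\in\mathcal{C}^1([0,1])$ with values in $[0,1]$. Suppose that $\mathcal{Z}(\mathbf{F})=\{\mathbf{z}\in[0,1]^N:\mathbf{F}(\mathbf{z})=\mathbf{0}\}$ contains only finitely many points of the form $z\mathbf{1}$, that $f$ admits a primitive function, and that for each fixed constant $c\in\left(-\frac{\alpha+\beta}{1-\alpha-\beta},0\right)$ the function $$\widetilde{\varphi}(z)=f(z)-\frac{1}{1-\alpha-\beta}z-c$$ has at most one zero in $[0,1]$. Then $\mathbf{Z}_n$ converges almost surely to a random variable of the form $\mathbf{Z}_\infty=Z_\infty\mathbf{1}$, where $Z_\infty$ is a $[0,1]$-valued random variable satisfying $$f(Z_\infty)-\frac{1-\alpha}{1-\alpha-\beta}Z_\infty+\frac{\beta q}{1-\alpha-\beta}=0 .$$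
   Context: Model. Let $N\ge 2$, $\alpha,\beta\in[0,1)$ with $\alpha+\beta\in(0,1)$, $q\in(0,1]$, and let $f:[0,1]\to[0,1]$ be strictly increasing and of class $\mathcal{C}^1([0,1])$. Let $(r_n)_{n\ge0}$ be a deterministic sequence in $[0,1]$ with $\lim_{n\to\infty} n r_n=1$. Let $Z_{0,h}$, $1\le h\le N$, be random variables with values in $[0,1]$. For $n\ge 0$ and $1\le h\le N$ set $Z_{n+1,h}=(1-r_n)Z_{n,h}+r_nI_{n+1,h}$, where the $I_{n+1,h}$ take values in $\{0,1\}$ and, given $\mathcal{F}_n=\sigma(Z_{0,h}:1\le h\le N)\vee\sigma(I_{k,h}:1\le k\le n,\,1\le h\le N)$, the variables $I_{n+1,1},\dots,I_{n+1,N}$ are conditionally independent with $$P(I_{n+1,h}=1\mid\mathcal{F}_n)=\alpha Z_n+\beta q+(1-\alpha-\beta)f(Z_{n,h}),\qquad Z_n=\frac1N\sum_{i=1}^N Z_{n,i}.$$ Write $\mathbf{Z}_n=(Z_{n,1},\dots,Z_{n,N})^\top$, and let $\mathbf{0}$, $\mathbf{1}$ be the vectors with all components equal to $0$, respectively $1$. Define $\mathbf{F}=(F_1,\dots,F_N)^\top$ on $[0,1]^N$ by $$F_h(\mathbf{z})=\alpha\frac1N\sum_{i=1}^Nz_i+\beta q+(1-\alpha-\beta)f(z_h)-z_h .$$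
   Formalization: When α=0 and q=1 the formal statement also assumes that φ̃ has at most one zero for the left endpoint c=−(α+β)/(1−α−β); without this the claim fails, e.g. N=2, α=0, β=1/2, q=1, f(z)=z³, r_n=1/(n+2), Z_0=(1,1/2). *)

theory Defs
  imports "HOL-Probability.Probability"
begin

(* One-sided derivatives at the endpoints: f is only meaningful on S, so C1_differentiable_on,
   which uses two-sided derivatives everywhere, would constrain f outside S. *)
definition C1_on :: "(real \<Rightarrow> real) \<Rightarrow> real set \<Rightarrow> bool" where
  "C1_on f S \<longleftrightarrow>
     (\<exists>f'. (\<forall>x\<in>S. (f has_real_derivative f' x) (at x within S)) \<and> continuous_on S f')"

definition has_primitive_on :: "(real \<Rightarrow> real) \<Rightarrow> real set \<Rightarrow> bool" where
  "has_primitive_on f S \<longleftrightarrow> (\<exists>G. \<forall>x\<in>S. (G has_real_derivative f x) (at x within S))"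

definition cond_prob_on :: "'a measure \<Rightarrow> 'a measure \<Rightarrow> 'a set \<Rightarrow> 'a \<Rightarrow> real" where
  "cond_prob_on M F A = real_cond_exp M F (indicator A)"

definition cond_indep_vars ::
    "'a measure \<Rightarrow> 'a measure \<Rightarrow> 'b measure \<Rightarrow> ('i \<Rightarrow> 'a \<Rightarrow> 'b) \<Rightarrow> 'i set \<Rightarrow> bool" where
  "cond_indep_vars M F N X S \<longleftrightarrow>
     (\<forall>i\<in>S. X i \<in> measurable M N) \<and>
     (\<forall>J A. J \<subseteq> S \<longrightarrow> finite J \<longrightarrow> (\<forall>j\<in>J. A j \<in> sets N) \<longrightarrow>
        (AE \<omega> in M. cond_prob_on M F {\<omega> \<in> space M. \<forall>j\<in>J. X j \<omega> \<in> A j} \<omega>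
           = (\<Prod>j\<in>J. cond_prob_on M F {\<omega> \<in> space M. X j \<omega> \<in> A j} \<omega>)))"

(* The sigma-algebra generated by Z_{0,h} and I_{k,h}, 1 \<le> k \<le> n, for all h. *)
definition history ::
    "'a measure \<Rightarrow> (nat \<Rightarrow> 'n \<Rightarrow> 'a \<Rightarrow> real) \<Rightarrow> (nat \<Rightarrow> 'n \<Rightarrow> 'a \<Rightarrow> real) \<Rightarrow> nat \<Rightarrow> 'a measure" where
  "history M Z I n = sigma (space M)
     ({Z 0 h -` A \<inter> space M | h A. A \<in> sets borel} \<union>
      {I k h -` A \<inter> space M | k h A. 1 \<le> k \<and> k \<le> n \<and> A \<in> sets borel})"

definition mean :: "('n::finite \<Rightarrow> real) \<Rightarrow> real" where
  "mean x = (1 / real CARD('n)) * (\<Sum>i\<in>UNIV. x i)"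

(* The N components are indexed by the finite type 'n, N = CARD('n).
   I 0 plays no role and is unconstrained. *)
locale interacting_reinforced = prob_space M
  for M :: "'a measure"
    and \<alpha> \<beta> q :: real and f :: "real \<Rightarrow> real" and r :: "nat \<Rightarrow> real"
    and Z I :: "nat \<Rightarrow> 'n::finite \<Rightarrow> 'a \<Rightarrow> real" +
  assumes N_ge_2: "CARD('n) \<ge> 2"
    and \<alpha>_range: "0 \<le> \<alpha>" "\<alpha> < 1"
    and \<beta>_range: "0 \<le> \<beta>" "\<beta> < 1"
    and \<alpha>\<beta>_range: "0 < \<alpha> + \<beta>" "\<alpha> + \<beta> < 1"
    and q_range: "0 < q" "q \<le> 1"
    and f_range: "f \<in> {0..1} \<rightarrow> {0..1}"
    and f_strict_mono: "strict_mono_on {0..1} f"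
    and f_C1: "C1_on f {0..1}"
    and r_range: "\<And>n. r n \<in> {0..1}"
    and r_lim: "(\<lambda>n. real n * r n) \<longlonglongrightarrow> 1"
    and Z0_measurable: "\<And>h. Z 0 h \<in> borel_measurable M"
    and Z0_range: "\<And>h \<omega>. \<omega> \<in> space M \<Longrightarrow> Z 0 h \<omega> \<in> {0..1}"
    and I_measurable: "\<And>n h. I (Suc n) h \<in> borel_measurable M"
    and I_range: "\<And>n h \<omega>. \<omega> \<in> space M \<Longrightarrow> I (Suc n) h \<omega> \<in> {0, 1}"
    and Z_Suc: "\<And>n h \<omega>. \<omega> \<in> space M \<Longrightarrow>
           Z (Suc n) h \<omega> = (1 - r n) * Z n h \<omega> + r n * I (Suc n) h \<omega>"
    and I_cond_indep: "\<And>n. cond_indep_vars M (history M Z I n) borel (I (Suc n)) UNIV"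
    and I_cond_prob: "\<And>n h. AE \<omega> in M.
           cond_prob_on M (history M Z I n) {\<omega> \<in> space M. I (Suc n) h \<omega> = 1} \<omega>
             = \<alpha> * mean (\<lambda>i. Z n i \<omega>) + \<beta> * q + (1 - \<alpha> - \<beta>) * f (Z n h \<omega>)"

definition F_field :: "real \<Rightarrow> real \<Rightarrow> real \<Rightarrow> (real \<Rightarrow> real) \<Rightarrow> real ^ 'n \<Rightarrow> real ^ 'n" where
  "F_field \<alpha> \<beta> q f z =
     (\<chi> h. \<alpha> * mean (\<lambda>i. z $ i) + \<beta> * q + (1 - \<alpha> - \<beta>) * f (z $ h) - z $ h)"

definition zeros_F :: "real \<Rightarrow> real \<Rightarrow> real \<Rightarrow> (real \<Rightarrow> real) \<Rightarrow> (real ^ 'n) set" where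
  "zeros_F \<alpha> \<beta> q f = {z. (\<forall>h. z $ h \<in> {0..1}) \<and> F_field \<alpha> \<beta> q f z = 0}"

(* For \<alpha> > 0 or q < 1, every c that arises from an equilibrium off the diagonal lies in the
   open interval (- (\<alpha> + \<beta>) / (1 - \<alpha> - \<beta>), 0).  If \<alpha> = 0 and q = 1, the c that arises
   is exactly its left endpoint, so a hypothesis on the open interval says nothing there and
   synchronisation can fail: take f z = z^3, \<beta> = 1/2, Z_0 = (1, 1/2). *)
definition phi_tilde :: "real \<Rightarrow> real \<Rightarrow> (real \<Rightarrow> real) \<Rightarrow> real \<Rightarrow> real \<Rightarrow> real" where
  "phi_tilde \<alpha> \<beta> f c z = f z - 1 / (1 - \<alpha> - \<beta>) * z - c"

end

theory Submission
  imports Defs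
begin

text \<open>With \<open>G' = f\<close>, the field \<open>F\<close> is minus the gradient of a potential which is half the squared norm
  minus a convex function, so one step of size \<open>r\<close> lowers the potential by \<open>r |F|\<^sup>2\<close>, up to a noise term
  and an error \<open>O(r\<^sup>2)\<close>. The noise series converge almost surely because \<open>r\<^sub>n = O(1/n)\<close> and the noise
  increments are bounded and orthogonal. Hence \<open>\<Sum> r\<^sub>n |F(Z\<^sub>n)|\<^sup>2\<close> converges, which forces
  \<open>F(Z\<^sub>n) \<longlonglongrightarrow> 0\<close>. A zero of \<open>F\<close> with mean \<open>m\<close> has all its components among the zeros of
  \<open>phi_tilde\<close> for \<open>c = - (\<alpha> m + \<beta> q) / (1 - \<alpha> - \<beta>)\<close>, so it lies on the diagonal
  (if this \<open>c\<close> leaves the open interval, either \<open>m \<in> {0, 1}\<close> or \<open>\<alpha> = 0\<close> and \<open>q = 1\<close>); the zeros are therefore finite in number, and as the step sizes vanish, \<open>Z\<^sub>n\<close> must settle at one of them.\<close>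

section \<open>Series with terms \<open>O(1/n)\<close>, grouped into blocks between consecutive
  cubes\<close>

lemma cube_block_ratio:
  "real ((Suc k)^3 - k^3) / (real k ^ 3 + 1) \<le> 13 / (real k + 1)"
proof -
  have len: "(Suc k)^3 - k^3 = 3 * k^2 + 3 * k + 1"
    by (simp add: power3_eq_cube power2_eq_square algebra_simps)
  have "k \<le> k^3" "k^2 \<le> k^3"
    by (cases k; simp add: power3_eq_cube power2_eq_square)+
  hence "real k \<le> real k ^ 3" "real k ^ 2 \<le> real k ^ 3"
    unfolding of_nat_power[symmetric] of_nat_le_iff by auto
  \<comment> \<open>The left side expands to \<open>3k^3 + 6k^2 + 4k + 1\<close>. Both
    \<open>k\<close> and \<open>k^2\<close> are at most \<open>k^3\<close>, so 13 arises as 3 + 6 +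
    4.\<close>
  hence "(3 * real k^2 + 3 * real k + 1) * (real k + 1) \<le> 13 * (real k ^ 3 + 1)"
    by (simp add: power3_eq_cube power2_eq_square algebra_simps)
  moreover have "0 < real k ^ 3 + 1" by (simp add: add_nonneg_pos)
  ultimately show ?thesis unfolding len by (simp add: field_simps)
qed

text \<open>A block between consecutive cubes has at least \<open>(k + 1)^2\<close> elements, so
  dividing \<open>cube_block_ratio\<close> by that number suffices and the constant 13 is
  inherited.\<close>

lemma inverse_cube_le: "1 / (real k ^ 3 + 1) \<le> 13 / (real k + 1) ^ 3"
proof -
  have "Suc k ^ 2 \<le> Suc k ^ 3 - k ^ 3"
    by (simp add: power3_eq_cube power2_eq_square algebra_simps)
  hence "real (Suc k ^ 2) \<le> real (Suc k ^ 3 - k ^ 3)" by (simp only: of_nat_le_iff)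
  hence "(real k + 1) ^ 2 \<le> real (Suc k ^ 3 - k ^ 3)" by (simp add: add.commute)
  hence "(real k + 1) ^ 2 / (real k ^ 3 + 1) \<le> real (Suc k ^ 3 - k ^ 3) / (real k ^ 3 + 1)"
    by (intro divide_right_mono) auto
  also have "\<dots> \<le> 13 / (real k + 1)" by (rule cube_block_ratio)
  finally have "(real k + 1) ^ 2 / (real k ^ 3 + 1) / (real k + 1) ^ 2 \<le> 13 / (real k + 1) / (real k + 1) ^ 2"
    by (intro divide_right_mono) auto
  moreover have "(real k + 1) ^ 3 = (real k + 1) * (real k + 1) ^ 2"
    by (simp add: power3_eq_cube power2_eq_square)
  ultimately show ?thesis by simp
qed

lemma harmonic_bound_on_block:
  assumes "\<bar>x n\<bar> \<le> C / real (Suc n)" "0 \<le> C" "k^3 \<le> n"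
  shows "\<bar>x n\<bar> \<le> C / (real k ^ 3 + 1)"
proof -
  have "real k ^ 3 + 1 \<le> real (Suc n)"
    using assms(3) by (metis of_nat_Suc of_nat_le_iff of_nat_power add.commute add_le_cancel_left)
  hence "C / real (Suc n) \<le> C / (real k ^ 3 + 1)"
    using assms(2) by (intro divide_left_mono) (auto intro!: mult_pos_pos add_nonneg_pos simp del: of_nat_Suc)
  thus ?thesis using assms(1) by linarith
qed

text \<open>Convergence along the cubes is enough: within the \<open>k\<close>-th block the partial
  sums move by at most the block length times the largest admissible term, which is
  \<open>O(1/k)\<close>.\<close>

lemma summable_of_cube_blocks:
  fixes x :: "nat \<Rightarrow> real"
  assumes bound: "\<And>n. \<bar>x n\<bar> \<le> C / real (Suc n)"
    and blocks: "summable (\<lambda>k. \<Sum>n\<in>{k^3..<(Suc k)^3}. x n)"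
  shows "summable x"
proof -
  have C: "0 \<le> C" using bound[of 0] by simp
  define P where "P n = (\<Sum>i<n. x i)" for n
  have diff: "P n - P m = sum x {m..<n}" if "m \<le> n" for m n
    using sum_diff_nat_ivl[of 0 m n x] that by (simp add: P_def lessThan_atLeast0)
  have P_cube: "P (k^3) = (\<Sum>j<k. \<Sum>n\<in>{j^3..<(Suc j)^3}. x n)" for k
  proof (induction k)
    case (Suc k)
    have "k^3 \<le> Suc k ^ 3" by (intro power_mono) auto
    from diff[OF this] Suc show ?case by simp
  qed (simp add: P_def)
  from blocks obtain L where L: "(\<lambda>k. P (k^3)) \<longlonglongrightarrow> L"
    unfolding P_cube summable_def sums_def by blast
  have in_block: "\<bar>P n - P (k^3)\<bar> \<le> C * (13 / (real k + 1))"
    if "k^3 \<le> n" "n < (Suc k)^3" for k n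
  proof -
    have "\<bar>P n - P (k^3)\<bar> \<le> (\<Sum>i\<in>{k^3..<n}. \<bar>x i\<bar>)"
      unfolding diff[OF that(1)] by (rule sum_abs)
    also have "\<dots> \<le> of_nat (card {k^3..<n}) * (C / (real k ^ 3 + 1))"
      by (intro sum_bounded_above harmonic_bound_on_block bound C) auto
    also have "\<dots> \<le> real ((Suc k)^3 - k^3) * (C / (real k ^ 3 + 1))"
      using that C by (intro mult_right_mono) (auto simp del: of_nat_diff of_nat_power)
    also have "\<dots> = C * (real ((Suc k)^3 - k^3) / (real k ^ 3 + 1))" by simp
    also have "\<dots> \<le> C * (13 / (real k + 1))"
      by (intro mult_left_mono cube_block_ratio C)
    finally show ?thesis .
  qed
  have "(\<lambda>k. C * (13 / (real k + 1))) \<longlonglongrightarrow> 0"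
    using tendsto_mult[OF tendsto_const[of "13 * C"] LIMSEQ_inverse_real_of_nat]
    by (simp add: field_simps)
  have "P \<longlonglongrightarrow> L"
  proof (rule LIMSEQ_I)
    fix e :: real assume e: "0 < e"
    obtain K1 where K1: "\<And>k. k \<ge> K1 \<Longrightarrow> norm (P (k^3) - L) < e/2"
      using LIMSEQ_D[OF L, of "e/2"] e by auto
    obtain K2 where K2: "\<And>k. k \<ge> K2 \<Longrightarrow> norm (C * (13 / (real k + 1)) - 0) < e/2"
      using LIMSEQ_D[OF \<open>(\<lambda>k. C * (13 / (real k + 1))) \<longlonglongrightarrow> 0\<close>, of "e/2"] e by auto
    have "norm (P n - L) < e" if n: "n \<ge> (max K1 K2)^3" for n
    proof -
      \<comment> \<open>\<open>k\<close> is the index of the block that contains \<open>n\<close>.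
        The number \<open>max K1 K2\<close> competes in this maximum, so \<open>k\<close> is large
        enough for both estimates.\<close>
      define k where "k = Max {k. k^3 \<le> n}"
      have *: "k \<le> n" if "k^3 \<le> n" for k :: nat
        using that self_le_power[of k 3] by (cases "k = 0") auto
      have fin: "finite {k. k^3 \<le> n}" by (rule finite_subset[of _ "{..n}"]) (use * in auto)
      have "k \<in> {k. k^3 \<le> n}" unfolding k_def by (rule Max_in[OF fin]) (auto intro: exI[of _ 0])
      moreover have "max K1 K2 \<le> k" unfolding k_def by (rule Max_ge[OF fin]) (use n in auto)
      moreover have "n < (Suc k)^3"
        using Max_ge[OF fin, of "Suc k"] unfolding k_def[symmetric] by (auto simp: not_le[symmetric])
      ultimately have "\<bar>P n - P (k^3)\<bar> \<le> C * (13 / (real k + 1))" "\<bar>P (k^3) - L\<bar> < e/2"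
        "\<bar>C * (13 / (real k + 1))\<bar> < e/2"
        using in_block[of k n] K1[of k] K2[of k] by (simp_all del: abs_mult times_divide_eq_right)
      thus ?thesis unfolding real_norm_def by linarith
    qed
    thus "\<exists>no. \<forall>n\<ge>no. norm (P n - L) < e" by blast
  qed
  thus ?thesis unfolding summable_def sums_def P_def by blast
qed

section \<open>Almost sure convergence of series of orthogonal random variables\<close>

context prob_space
begin

text \<open>Pythagoras: after expanding the square only the diagonal terms survive, and each is at
  most \<open>B^2\<close>. Boundedness makes every product integrable.\<close>

lemma second_moment_orthogonal_sum:
  fixes X :: "'i \<Rightarrow> 'a \<Rightarrow> real"
  assumes meas: "\<And>n. n \<in> A \<Longrightarrow> X n \<in> borel_measurable M"
    and bound: "\<And>n \<omega>. n \<in> A \<Longrightarrow> \<omega> \<in> space M \<Longrightarrow> \<bar>X n \<omega>\<bar> \<le> B"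
    and orth: "\<And>m n. m \<in> A \<Longrightarrow> n \<in> A \<Longrightarrow> m \<noteq> n \<Longrightarrow> expectation (\<lambda>\<omega>. X m \<omega> * X n \<omega>) = 0"
    and "finite A"
  shows "integrable M (\<lambda>\<omega>. (\<Sum>n\<in>A. X n \<omega>)^2)"
    and "expectation (\<lambda>\<omega>. (\<Sum>n\<in>A. X n \<omega>)^2) \<le> real (card A) * B^2"
proof -
  have int: "integrable M (\<lambda>\<omega>. X m \<omega> * X n \<omega>)" if "m \<in> A" "n \<in> A" for m n
    using that meas bound
    by (intro integrable_const_bound[where B = "B * B"])
       (auto simp: abs_mult intro!: mult_mono order_trans[OF abs_ge_zero bound])
  have sq: "(\<Sum>n\<in>A. X n \<omega>)^2 = (\<Sum>m\<in>A. \<Sum>n\<in>A. X m \<omega> * X n \<omega>)" for \<omega>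
    by (simp add: power2_eq_square sum_product)
  show "integrable M (\<lambda>\<omega>. (\<Sum>n\<in>A. X n \<omega>)^2)"
    unfolding sq using int by (intro Bochner_Integration.integrable_sum)
  have "expectation (\<lambda>\<omega>. (\<Sum>n\<in>A. X n \<omega>)^2)
      = (\<Sum>m\<in>A. \<Sum>n\<in>A. expectation (\<lambda>\<omega>. X m \<omega> * X n \<omega>))"
    unfolding sq using int by (simp add: Bochner_Integration.integral_sum)
  also have "\<dots> = (\<Sum>m\<in>A. expectation (\<lambda>\<omega>. X m \<omega> * X m \<omega>))"
  proof (rule sum.cong[OF refl])
    fix m assume m: "m \<in> A"
    have "(\<Sum>n\<in>A. expectation (\<lambda>\<omega>. X m \<omega> * X n \<omega>))
        = (\<Sum>n\<in>A. if n = m then expectation (\<lambda>\<omega>. X m \<omega> * X m \<omega>) else 0)"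
      using orth[OF m] by (intro sum.cong) auto
    thus "(\<Sum>n\<in>A. expectation (\<lambda>\<omega>. X m \<omega> * X n \<omega>)) = expectation (\<lambda>\<omega>. X m \<omega> * X m \<omega>)"
      using m \<open>finite A\<close> by simp
  qed
  also have "\<dots> \<le> real (card A) * B^2"
  proof (rule sum_bounded_above)
    fix m assume m: "m \<in> A"
    have "expectation (\<lambda>\<omega>. X m \<omega> * X m \<omega>) \<le> expectation (\<lambda>_. B^2)"
    proof (rule integral_mono)
      fix \<omega> assume "\<omega> \<in> space M"
      from power_mono[OF bound[OF m this] abs_ge_zero, of 2]
      show "X m \<omega> * X m \<omega> \<le> B^2" unfolding power2_abs by (simp only: power2_eq_square)
    qed (rule int[OF m m], simp)
    thus "expectation (\<lambda>\<omega>. X m \<omega> * X m \<omega>) \<le> B^2" by (simp add: prob_space)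
  qed
  finally show "expectation (\<lambda>\<omega>. (\<Sum>n\<in>A. X n \<omega>)^2) \<le> real (card A) * B^2" .
qed

text \<open>Sum and integral of nonnegative terms commute, so the random series has finite
  expectation and is finite almost everywhere.\<close>

lemma AE_summable_of_summable_expectation:
  fixes Y :: "nat \<Rightarrow> 'a \<Rightarrow> real"
  assumes int: "\<And>k. integrable M (Y k)"
    and nonneg: "\<And>k \<omega>. 0 \<le> Y k \<omega>"
    and sum: "summable (\<lambda>k. expectation (Y k))"
  shows "AE \<omega> in M. summable (\<lambda>k. Y k \<omega>)"
proof -
  have [measurable]: "Y k \<in> borel_measurable M" for k using int by auto
  have "(\<integral>\<^sup>+\<omega>. (\<Sum>k. ennreal (Y k \<omega>)) \<partial>M) = (\<Sum>k. \<integral>\<^sup>+\<omega>. ennreal (Y k \<omega>) \<partial>M)"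
    by (rule nn_integral_suminf) simp
  also have "\<dots> = (\<Sum>k. ennreal (expectation (Y k)))"
    using int nonneg by (simp add: nn_integral_eq_integral)
  also have "\<dots> = ennreal (\<Sum>k. expectation (Y k))"
    using sum nonneg by (intro suminf_ennreal2) (auto intro: integral_nonneg)
  finally have "(\<integral>\<^sup>+\<omega>. (\<Sum>k. ennreal (Y k \<omega>)) \<partial>M) \<noteq> \<infinity>" by simp
  hence "AE \<omega> in M. (\<Sum>k. ennreal (Y k \<omega>)) \<noteq> \<infinity>"
    by (intro nn_integral_PInf_AE) auto
  thus ?thesis
    by eventually_elim (rule summable_suminf_not_top, auto simp: nonneg)
qed

text \<open>Replaces the martingale convergence theorem: the cubes are sparse enough for the
  \<open>L\<^sup>2\<close> norms of the blocks between them to be summable, and dense enough for the harmonic weights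
  to sum to \<open>O(1/k)\<close> within the \<open>k\<close>-th block.\<close>

lemma AE_summable_orthogonal:
  fixes X :: "nat \<Rightarrow> 'a \<Rightarrow> real"
  assumes meas: "\<And>n. X n \<in> borel_measurable M"
    and bound: "\<And>n \<omega>. \<omega> \<in> space M \<Longrightarrow> \<bar>X n \<omega>\<bar> \<le> C / real (Suc n)"
    and orth: "\<And>m n. m < n \<Longrightarrow> expectation (\<lambda>\<omega>. X m \<omega> * X n \<omega>) = 0"
  shows "AE \<omega> in M. summable (\<lambda>n. X n \<omega>)"
proof -
  obtain \<omega>0 where \<omega>0: "\<omega>0 \<in> space M" using not_empty by blast
  have C: "0 \<le> C" using bound[OF \<omega>0, of 0] by simp
  define A where "A k = {k^3..<(Suc k)^3}" for k :: nat
  define S where "S k \<omega> = (\<Sum>n\<in>A k. X n \<omega>)" for k \<omega>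
  have orth': "expectation (\<lambda>\<omega>. X m \<omega> * X n \<omega>) = 0" if "m \<noteq> n" for m n
    using orth[of m n] orth[of n m] that by (cases m n rule: linorder_cases) (auto simp: mult.commute)
  have block: "\<bar>X n \<omega>\<bar> \<le> C / (real k ^ 3 + 1)" if "n \<in> A k" "\<omega> \<in> space M" for n k \<omega>
    using that by (intro harmonic_bound_on_block[of "\<lambda>n. X n \<omega>"] bound C) (auto simp: A_def)
  have int: "integrable M (\<lambda>\<omega>. (S k \<omega>)^2)"
    and var: "expectation (\<lambda>\<omega>. (S k \<omega>)^2) \<le> real (card (A k)) * (C / (real k ^ 3 + 1))^2" for k
    unfolding S_def
    by (rule second_moment_orthogonal_sum[where B = "C / (real k ^ 3 + 1)"];
        use meas block orth' in \<open>auto simp: A_def\<close>)+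
  \<comment> \<open>The weight \<open>(k + 1)^2\<close> is as large as possible while the
    expectations, of order \<open>1/(k + 1)^2\<close>, remain clearly summable; it pays for passing
    from \<open>(S k)^2\<close> to the absolute value of \<open>S k\<close> below.\<close>
  define Y where "Y k \<omega> = (real k + 1)^2 * (S k \<omega>)^2" for k \<omega>
  have "AE \<omega> in M. summable (\<lambda>k. Y k \<omega>)"
  proof (rule AE_summable_of_summable_expectation)
    show "integrable M (Y k)" for k unfolding Y_def using int by auto
    show "0 \<le> Y k \<omega>" for k \<omega> by (simp add: Y_def)
    have power_eq: "C^2 * t^2 * ((13 / t) * (13 / t^3)) = 169 * C^2 * (1 / t^2)" if "0 < t" for t :: real
      using that by (simp add: field_simps eval_nat_numeral)
    have "expectation (Y k) \<le> 169 * C^2 * (1 / (real k + 1)^2)" for k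
    proof -
      have "expectation (Y k) \<le> (real k + 1)^2 * (real (card (A k)) * (C / (real k ^ 3 + 1))^2)"
        unfolding Y_def using var[of k] by (simp add: mult_left_mono)
      \<comment> \<open>One of the two factors \<open>1 / (k^3 + 1)\<close> is paired with the block
        length, giving order \<open>1/k\<close>; the other one alone has order
        \<open>1/k^3\<close>.\<close>
      also have "\<dots> = C^2 * (real k + 1)^2 *
          ((real ((Suc k)^3 - k^3) / (real k ^ 3 + 1)) * (1 / (real k ^ 3 + 1)))"
        by (simp add: A_def power2_eq_square)
      also have "\<dots> \<le> C^2 * (real k + 1)^2 * ((13 / (real k + 1)) * (13 / (real k + 1)^3))"
        by (intro mult_left_mono mult_mono cube_block_ratio inverse_cube_le) auto
      also have "\<dots> = 169 * C^2 * (1 / (real k + 1)^2)"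
        by (rule power_eq) simp
      finally show ?thesis .
    qed
    moreover have "summable (\<lambda>k. 1 / (real k + 1)^2)"
      using inverse_squares_sums by (simp add: sums_iff add.commute)
    moreover have "0 \<le> expectation (Y k)" for k
      by (intro integral_nonneg_AE) (simp add: Y_def)
    ultimately show "summable (\<lambda>k. expectation (Y k))"
      by - (rule summable_comparison_test'[OF summable_mult[of "\<lambda>k. 1 / (real k + 1)^2" "169 * C^2"]],
         simp_all only: real_norm_def abs_of_nonneg)
  qed
  moreover have "summable (\<lambda>n. X n \<omega>)" if Y: "summable (\<lambda>k. Y k \<omega>)" and \<omega>: "\<omega> \<in> space M" for \<omega>
  proof (rule summable_of_cube_blocks)
    show "\<bar>X n \<omega>\<bar> \<le> C / real (Suc n)" for n using bound[OF \<omega>] .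
    have "\<bar>S k \<omega>\<bar> \<le> 1 / (real k + 1)^2 + Y k \<omega>" for k
    proof -
      \<comment> \<open>The inequality of arithmetic and geometric means with weight
        \<open>u = k + 1\<close> bounds each block sum by two summable quantities.\<close>
      have sq: "(1 / u - u * s)^2 = 1 / u^2 + u^2 * s^2 - 2 * s" if "0 < u" for u s :: real
        using that by (simp add: power2_eq_square field_simps)
      have "0 \<le> (1 / (real k + 1) - (real k + 1) * \<bar>S k \<omega>\<bar>)^2" by (rule zero_le_power2)
      also have "\<dots> = 1 / (real k + 1)^2 + (real k + 1)^2 * \<bar>S k \<omega>\<bar>^2 - 2 * \<bar>S k \<omega>\<bar>"
        by (rule sq) simp
      finally have "2 * \<bar>S k \<omega>\<bar> \<le> 1 / (real k + 1)^2 + Y k \<omega>"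
        unfolding Y_def power2_abs by linarith
      thus ?thesis by linarith
    qed
    moreover have "summable (\<lambda>k. 1 / (real k + 1)^2)"
      using inverse_squares_sums by (simp add: sums_iff add.commute)
    ultimately have "summable (\<lambda>k. S k \<omega>)"
      using Y by - (rule summable_comparison_test'[OF summable_add[of "\<lambda>k. 1 / (real k + 1)^2" "\<lambda>k. Y k \<omega>"]],
        simp_all only: real_norm_def)
    thus "summable (\<lambda>k. \<Sum>n\<in>{k^3..<(Suc k)^3}. X n \<omega>)" by (simp add: S_def A_def)
  qed
  ultimately show ?thesis
    using AE_space[of M] by (auto elim!: eventually_elim2)
qed

end

section \<open>Deterministic analysis of the iteration: energy, vanishing field, convergence to a
  zero\<close>

text \<open>A pathwise analogue of the Robbins-Siegmund lemma. Telescoping bounds the partial sums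
  of \<open>A\<close> by the total drop of \<open>V\<close> plus partial sums of
  \<open>c - b\<close>. These are bounded even when \<open>b\<close> converges only conditionally,
  as the noise term does.\<close>

lemma summable_of_descent:
  fixes V A b c :: "nat \<Rightarrow> real"
  assumes descent: "\<And>n. V (Suc n) \<le> V n - A n - b n + c n"
    and "\<And>n. 0 \<le> A n" and below: "\<And>n. v \<le> V n"
    and b: "summable b" and c: "summable c"
  shows "summable A"
proof -
  have "Bseq (\<lambda>n. \<Sum>i<n. c i - b i)"
    using summable_LIMSEQ[OF summable_diff[OF c b]] by (intro convergent_imp_Bseq convergentI)
  then obtain K where K: "\<And>n. \<bar>\<Sum>i<n. c i - b i\<bar> \<le> K" by (auto simp: Bseq_def)
  have "(\<Sum>i<n. A i) \<le> V 0 - V n + (\<Sum>i<n. c i - b i)" for n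
  proof (induction n)
    case (Suc n) thus ?case using descent[of n] by simp
  qed simp
  hence "(\<Sum>i<n. A i) \<le> V 0 - v + K" for n
    using K[of n] below[of n] by (smt (verit))
  thus ?thesis by (intro summableI_nonneg_bounded assms)
qed

text \<open>The window ends as soon as its mass reaches 1. Before the last step the mass is below 1,
  and that step adds at most 1.\<close>

lemma window_of_unit_mass:
  fixes r :: "nat \<Rightarrow> real"
  assumes r: "\<And>n. 0 \<le> r n" "\<And>n. r n \<le> 1" and div: "\<not> summable r"
  shows "\<exists>m\<ge>n. 1 \<le> sum r {n..<m} \<and> sum r {n..<m} \<le> 2"
proof -
  have "\<exists>m\<ge>n. 1 \<le> sum r {n..<m}"
  proof (rule ccontr)
    assume "\<not> ?thesis"
    hence *: "sum r {n..<m} < 1" if "n \<le> m" for m using that by (meson not_le)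
    have "(\<Sum>i<m. r i) \<le> (\<Sum>i<n. r i) + 1" for m
    proof (cases "n \<le> m")
      case True
      have "(\<Sum>i<m. r i) = (\<Sum>i<n. r i) + sum r {n..<m}"
        using sum.atLeastLessThan_concat[of 0 n m r] True by (simp add: lessThan_atLeast0)
      thus ?thesis using *[OF True] by simp
    next
      case False
      hence "(\<Sum>i<m. r i) \<le> (\<Sum>i<n. r i)" by (intro sum_mono2) (auto simp: r)
      thus ?thesis by simp
    qed
    hence "summable r" by (intro summableI_nonneg_bounded r)
    with div show False by blast
  qed
  from exists_least_iff[THEN iffD1, OF this]
  obtain m where m: "n \<le> m" "1 \<le> sum r {n..<m}"
    and "\<forall>k<m. \<not> (n \<le> k \<and> 1 \<le> sum r {n..<k})" by blast
  hence least: "sum r {n..<k} < 1" if "k < m" "n \<le> k" for k using that by (meson not_le)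
  have "n < m" using m by (cases "n = m") auto
  then obtain k where k: "m = Suc k" "n \<le> k" by (cases m) auto
  have "sum r {n..<m} \<le> 2" using least[of k] k r(2)[of k] by simp
  thus ?thesis using m by blast
qed

text \<open>On a window of step mass in \<open>[1, 2]\<close> the summability of \<open>r\<^sub>n |F(z\<^sub>n)|\<^sup>2\<close> forces the iteration to
  stay put, so \<open>F\<close> is nearly constant along it and cannot be large there.\<close>

lemma drift_tendsto_0:
  fixes z e :: "nat \<Rightarrow> 'b::banach" and F :: "'b \<Rightarrow> 'c::real_normed_vector"
  assumes r: "\<And>n. 0 \<le> r n" "\<And>n. r n \<le> 1" "\<not> summable r"
    and F: "uniformly_continuous_on K F" and z: "\<And>n. z n \<in> K"
    and step: "\<And>n. norm (z (Suc n) - z n - e n) \<le> r n * norm (F (z n))"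
    and e: "summable e"
    and energy: "summable (\<lambda>n. r n * (norm (F (z n)))^2)"
  shows "(\<lambda>n. F (z n)) \<longlonglongrightarrow> 0"
proof (rule LIMSEQ_I)
  fix \<epsilon> :: real assume \<epsilon>: "0 < \<epsilon>"
  define g where "g n = norm (F (z n))" for n
  obtain d where d: "0 < d" and unif: "\<And>x y. x \<in> K \<Longrightarrow> y \<in> K \<Longrightarrow> dist y x < d \<Longrightarrow> dist (F y) (F x) < \<epsilon>/2"
    using F \<epsilon> unfolding uniformly_continuous_on_def by (metis half_gt_zero)
  \<comment> \<open>Along the window the drift moves the point by at most
    \<open>3 * \<delta>\<close> and the noise by less than \<open>\<delta>\<close>, so the total
    stays below \<open>d\<close>.\<close>
  define \<delta> where "\<delta> = d / 6"
  have \<delta>: "0 < \<delta>" using d by (simp add: \<delta>_def)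
  \<comment> \<open>The first entry gives \<open>\<eta> / \<delta> \<le> \<delta>\<close> in the
    displacement bound; the second is the energy that a window would spend if the norm of
    \<open>F\<close> stayed above \<open>\<epsilon>/2\<close>.\<close>
  define \<eta> where "\<eta> = min (\<delta> * \<delta>) (\<epsilon>^2/4)"
  have \<eta>: "0 < \<eta>" using \<delta> \<epsilon> by (simp add: \<eta>_def)
  from e[unfolded summable_Cauchy, rule_format, OF \<delta>]
  obtain N1 where N1: "\<And>m n. N1 \<le> n \<Longrightarrow> norm (sum e {n..<m}) < \<delta>" by blast
  from energy[unfolded summable_Cauchy, rule_format, OF \<eta>, folded g_def]
  obtain N2 where N2: "\<And>m n. N2 \<le> n \<Longrightarrow> norm (\<Sum>k\<in>{n..<m}. r k * (g k)^2) < \<eta>" by blast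
  have "g n < \<epsilon>" if n: "max N1 N2 \<le> n" for n
  proof (rule ccontr)
    assume "\<not> g n < \<epsilon>"
    hence gn: "\<epsilon> \<le> g n" by simp
    obtain m where m: "n \<le> m" "1 \<le> sum r {n..<m}" "sum r {n..<m} \<le> 2"
      using window_of_unit_mass[OF r] by blast
    have near: "norm (z k - z n) < d" if k: "n \<le> k" "k \<le> m" for k
    proof -
      have tele: "z k - z n = (\<Sum>i\<in>{n..<k}. z (Suc i) - z i - e i) + sum e {n..<k}"
        using sum_Suc_diff'[OF k(1), of z] by (simp add: sum_subtractf)
      have "norm (\<Sum>i\<in>{n..<k}. z (Suc i) - z i - e i) \<le> (\<Sum>i\<in>{n..<k}. r i * g i)"
        unfolding g_def by (rule sum_norm_le) (rule step)
      also have "\<dots> \<le> (\<Sum>i\<in>{n..<k}. \<delta> * r i + (r i * (g i)^2) / \<delta>)"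
      proof (rule sum_mono)
        fix i
        \<comment> \<open>A Young-type inequality converts path length, linear in \<open>g\<close>,
          into step mass plus energy, which is quadratic in \<open>g\<close>.\<close>
        have "0 \<le> (g i - \<delta>)^2 + \<delta> * g i" using \<delta> by (simp add: g_def)
        hence "g i * \<delta> \<le> \<delta> * \<delta> + (g i)^2" by (simp add: power2_eq_square algebra_simps)
        hence "g i \<le> \<delta> + (g i)^2 / \<delta>" using \<delta> by (simp add: field_simps)
        from mult_left_mono[OF this r(1)[of i]]
        show "r i * g i \<le> \<delta> * r i + (r i * (g i)^2) / \<delta>" by (simp add: algebra_simps)
      qed
      also have "\<dots> = \<delta> * sum r {n..<k} + (\<Sum>i\<in>{n..<k}. r i * (g i)^2) / \<delta>"
        by (simp add: sum.distrib sum_distrib_left sum_divide_distrib)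
      also have "\<dots> \<le> \<delta> * 2 + \<eta> / \<delta>"
      proof (intro add_mono mult_left_mono divide_right_mono)
        have "sum r {n..<k} \<le> sum r {n..<m}" using k r by (intro sum_mono2) auto
        thus "sum r {n..<k} \<le> 2" using m by simp
        show "(\<Sum>i\<in>{n..<k}. r i * (g i)^2) \<le> \<eta>" using N2[of n k] n by simp
      qed (use \<delta> in auto)
      also have "\<eta> / \<delta> \<le> \<delta>" using \<delta> by (simp add: \<eta>_def field_simps)
      finally have "norm (\<Sum>i\<in>{n..<k}. z (Suc i) - z i - e i) \<le> 3 * \<delta>" by simp
      moreover have "norm (sum e {n..<k}) < \<delta>" using N1 n by simp
      ultimately have "norm (z k - z n) < 4 * \<delta>"
        unfolding tele by (intro le_less_trans[OF norm_triangle_ineq]) linarith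
      thus ?thesis using \<delta> by (simp add: \<delta>_def)
    qed
    have large: "\<epsilon>/2 \<le> g k" if k: "n \<le> k" "k \<le> m" for k
    proof -
      have "dist (F (z k)) (F (z n)) < \<epsilon>/2"
        by (rule unif) (use near[OF k] z in \<open>auto simp: dist_norm\<close>)
      hence "g n - g k < \<epsilon>/2"
        using norm_triangle_ineq3[of "F (z k)" "F (z n)"] by (simp add: g_def dist_norm abs_le_iff)
      thus ?thesis using gn by simp
    qed
    have "\<epsilon>^2/4 \<le> \<epsilon>^2/4 * sum r {n..<m}"
      using mult_left_mono[OF m(2), of "\<epsilon>^2/4"] by simp
    also have "\<dots> = (\<Sum>k\<in>{n..<m}. r k * (\<epsilon>/2)^2)"
      unfolding sum_distrib_right[symmetric] by (simp add: power_divide)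
    also have "\<dots> \<le> (\<Sum>k\<in>{n..<m}. r k * (g k)^2)"
      using large \<epsilon> r by (intro sum_mono mult_left_mono power_mono) auto
    also have "\<dots> < \<eta>" using N2[of n m] n by simp
    also have "\<dots> \<le> \<epsilon>^2/4" by (simp add: \<eta>_def)
    finally show False by simp
  qed
  thus "\<exists>no. \<forall>n\<ge>no. norm (F (z n) - 0) < \<epsilon>"
    unfolding g_def by (intro exI[of _ "max N1 N2"]) auto
qed

text \<open>Removing the open balls around the zeros leaves a compact set on which the norm of
  \<open>F\<close> has a positive minimum; the sequence eventually avoids that set.\<close>

lemma eventually_near_zeros:
  fixes F :: "'b::metric_space \<Rightarrow> 'c::real_normed_vector"
  assumes K: "compact K" "continuous_on K F" and z: "\<And>n. z n \<in> K"
    and lim: "(\<lambda>n. F (z n)) \<longlonglongrightarrow> 0" and e: "0 < e"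
  shows "\<exists>N. \<forall>n\<ge>N. \<exists>a\<in>K. F a = 0 \<and> dist (z n) a < e"
proof -
  define B where "B = K - (\<Union>a\<in>{a\<in>K. F a = 0}. ball a e)"
  have "compact B" unfolding B_def by (intro compact_diff K) auto
  have "\<exists>\<delta>>0. \<forall>x\<in>B. \<delta> \<le> norm (F x)"
  proof (cases "B = {}")
    case False
    have "continuous_on B (\<lambda>x. norm (F x))"
      by (intro continuous_on_norm continuous_on_subset[OF K(2)]) (auto simp: B_def)
    from continuous_attains_inf[OF \<open>compact B\<close> False this]
    obtain x where x: "x \<in> B" "\<And>y. y \<in> B \<Longrightarrow> norm (F x) \<le> norm (F y)" by blast
    have "F x \<noteq> 0" using x(1) e by (auto simp: B_def)
    thus ?thesis using x by (intro exI[of _ "norm (F x)"]) auto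
  qed (auto intro: exI[of _ 1])
  then obtain \<delta> where \<delta>: "0 < \<delta>" "\<And>x. x \<in> B \<Longrightarrow> \<delta> \<le> norm (F x)" by blast
  obtain N where N: "\<And>n. N \<le> n \<Longrightarrow> norm (F (z n)) < \<delta>"
    using LIMSEQ_D[OF lim \<delta>(1)] by auto
  have "\<exists>a\<in>K. F a = 0 \<and> dist (z n) a < e" if "N \<le> n" for n
  proof -
    have "z n \<notin> B" using N[OF that] \<delta>(2)[of "z n"] by linarith
    thus ?thesis using z[of n] by (auto simp: B_def dist_commute)
  qed
  thus ?thesis by blast
qed

text \<open>Distinct zeros are at least \<open>\<delta>\<close> apart. Once every iterate is within
  \<open>\<delta>/3\<close> of some zero and every step is shorter than \<open>\<delta>/3\<close>,
  changing from one zero to another is impossible.\<close>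

lemma convergent_to_isolated_zero:
  fixes F :: "'b::metric_space \<Rightarrow> 'c::real_normed_vector"
  assumes K: "compact K" "continuous_on K F" and z: "\<And>n. z n \<in> K"
    and lim: "(\<lambda>n. F (z n)) \<longlonglongrightarrow> 0"
    and fin: "finite {a\<in>K. F a = 0}"
    and steps: "(\<lambda>n. dist (z (Suc n)) (z n)) \<longlonglongrightarrow> 0"
  shows "\<exists>a\<in>K. F a = 0 \<and> z \<longlonglongrightarrow> a"
proof -
  define A where "A = {a\<in>K. F a = 0}"
  have "\<exists>\<delta>>0. \<forall>a\<in>A. \<forall>b\<in>A. a \<noteq> b \<longrightarrow> \<delta> \<le> dist a b"
  proof (cases "A = {}")
    case False
    have "\<forall>a. \<exists>\<delta>>0. \<forall>b\<in>A. b \<noteq> a \<longrightarrow> \<delta> \<le> dist a b"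
      using finite_set_avoid fin A_def by blast
    then obtain d where d: "\<And>a. 0 < d a" "\<And>a b. b \<in> A \<Longrightarrow> b \<noteq> a \<Longrightarrow> d a \<le> dist a b" by metis
    have "finite (d ` A)" "d ` A \<noteq> {}" using fin False by (auto simp: A_def)
    hence "0 < Min (d ` A)" "\<And>a. a \<in> A \<Longrightarrow> Min (d ` A) \<le> d a" using d(1) by auto
    thus ?thesis using d(2) by (intro exI[of _ "Min (d ` A)"]) (metis order_trans)
  qed (auto intro: exI[of _ 1])
  then obtain \<delta> where \<delta>: "0 < \<delta>" "\<And>a b. a \<in> A \<Longrightarrow> b \<in> A \<Longrightarrow> a \<noteq> b \<Longrightarrow> \<delta> \<le> dist a b" by blast
  have near: "\<exists>N. \<forall>n\<ge>N. \<exists>a\<in>A. dist (z n) a < e" if "0 < e" for e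
    using eventually_near_zeros[OF K, of z, OF z lim that] by (simp add: A_def Bex_def conj_assoc)
  obtain N1 where N1: "\<And>n. N1 \<le> n \<Longrightarrow> \<exists>a\<in>A. dist (z n) a < \<delta>/3"
    using near[of "\<delta>/3"] \<delta>(1) by auto
  obtain N2 where N2: "\<And>n. N2 \<le> n \<Longrightarrow> dist (z (Suc n)) (z n) < \<delta>/3"
    using LIMSEQ_D[OF steps, of "\<delta>/3"] \<delta>(1) by auto
  define N where "N = max N1 N2"
  obtain a where a: "a \<in> A" "dist (z N) a < \<delta>/3" using N1[of N] by (auto simp: N_def)
  have stay: "dist (z n) a < \<delta>/3" if "N \<le> n" for n
    using that
  proof (induction n rule: dec_induct)
    case (step n)
    obtain b where b: "b \<in> A" "dist (z (Suc n)) b < \<delta>/3"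
      using N1[of "Suc n"] step by (auto simp: N_def)
    have "dist a b \<le> dist (z n) a + dist (z (Suc n)) (z n) + dist (z (Suc n)) b"
      using dist_triangle2[of a b "z (Suc n)"] dist_triangle2[of a "z (Suc n)" "z n"]
      by (simp add: dist_commute)
    also have "\<dots> < \<delta>" using b N2[of n] step by (simp add: N_def)
    finally show ?case using \<delta>(2)[OF a(1) b(1)] b by force
  qed (use a in simp)
  have "z \<longlonglongrightarrow> a"
  proof (rule metric_LIMSEQ_I)
    fix e :: real assume e: "0 < e"
    \<comment> \<open>The cap \<open>\<delta>/3\<close> ensures that the zero found at the finer
      scale is the same \<open>a\<close>.\<close>
    define e' where "e' = min e (\<delta>/3)"
    obtain N' where N': "\<And>n. N' \<le> n \<Longrightarrow> \<exists>b\<in>A. dist (z n) b < e'"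
      using near[of e'] e \<delta>(1) by (auto simp: e'_def)
    have "dist (z n) a < e" if n: "max N N' \<le> n" for n
    proof -
      obtain b where b: "b \<in> A" "dist (z n) b < e'" using N'[of n] n by auto
      have "dist a b \<le> dist (z n) a + dist (z n) b"
        using dist_triangle3[of a b "z n"] by (simp add: dist_commute)
      also have "\<dots> < \<delta>" using b stay[of n] n \<delta>(1) by (simp add: e'_def)
      finally have "a = b" using \<delta>(2)[OF a(1) b(1)] by force
      thus ?thesis using b by (simp add: e'_def)
    qed
    thus "\<exists>no. \<forall>n\<ge>no. dist (z n) a < e" by blast
  qed
  thus ?thesis using a(1) by (auto simp: A_def)
qed

lemma harmonic_steps:
  fixes r :: "nat \<Rightarrow> real"
  assumes r: "\<And>n. 0 \<le> r n" and lim: "(\<lambda>n. real n * r n) \<longlonglongrightarrow> 1"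
  shows harmonic_steps_bound: "\<exists>C. \<forall>n. r n \<le> C / real (Suc n)"
    and harmonic_steps_square_summable: "summable (\<lambda>n. (r n)^2)"
    and harmonic_steps_tendsto_0: "r \<longlonglongrightarrow> 0"
    and harmonic_steps_not_summable: "\<not> summable r"
proof -
  obtain K where K: "\<And>n. \<bar>real n * r n\<bar> \<le> K"
    using convergent_imp_Bseq[OF convergentI[OF lim]] by (auto simp: Bseq_def)
  \<comment> \<open>For positive \<open>n\<close> the factor 2 absorbs the shift from
    \<open>n\<close> to \<open>n + 1\<close>; the summand \<open>r 0\<close> covers
    \<open>n = 0\<close>, where the limit gives no control.\<close>
  define C where "C = 2 * K + r 0"
  have K0: "0 \<le> K" using K[of 0] by simp
  have C: "r n \<le> C / real (Suc n)" for n
  proof (cases n)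
    case (Suc k)
    have "r n \<le> real n * r n" using r[of n] Suc by (simp add: algebra_simps)
    hence "real (Suc n) * r n \<le> 2 * K" using K[of n] by (simp add: algebra_simps)
    thus ?thesis using r[of 0] by (simp add: C_def field_simps)
  qed (use K0 in \<open>simp add: C_def\<close>)
  thus "\<exists>C. \<forall>n. r n \<le> C / real (Suc n)" by blast
  have "summable (\<lambda>n. C^2 * (1 / (real n + 1)^2))"
    using inverse_squares_sums by (intro summable_mult) (simp add: sums_iff add.commute)
  moreover have "norm ((r n)^2) \<le> C^2 * (1 / (real n + 1)^2)" for n
    using power_mono[OF C[of n] r, of 2] by (simp add: power_divide add.commute)
  ultimately show "summable (\<lambda>n. (r n)^2)" by (rule summable_comparison_test'[where N = 0])
  from tendsto_mult[OF tendsto_const[of C] LIMSEQ_inverse_real_of_nat]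
  have "(\<lambda>n. C / real (Suc n)) \<longlonglongrightarrow> 0" by (simp add: divide_inverse)
  thus "r \<longlonglongrightarrow> 0" by (rule tendsto_sandwich[OF _ _ tendsto_const, rotated 2])
     (intro always_eventually allI r C)+
  show "\<not> summable r"
  proof
    assume "summable r"
    hence "summable (\<lambda>n. 2 * r n)" by (rule summable_mult)
    \<comment> \<open>Since \<open>n * r n\<close> tends to 1, it eventually exceeds 1/2, and the
      harmonic series is dominated by \<open>2 * r n\<close>.\<close>
    moreover have "eventually (\<lambda>n. norm (1 / real n) \<le> 2 * r n) sequentially"
    proof -
      have "eventually (\<lambda>n. 1/2 < real n * r n) sequentially"
        using order_tendstoD(1)[OF lim, of "1/2"] by simp
      thus ?thesis using eventually_gt_at_top[of 0] by eventually_elim (simp add: field_simps)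
    qed
    ultimately have "summable (\<lambda>n. 1 / real n)"
      by (rule summable_comparison_test_ev[rotated])
    thus False using not_summable_harmonic[where 'a = real] by (simp add: inverse_eq_divide)
  qed
qed

section \<open>The potential of the field and the location of its zeros\<close>

lemma C1_on_imp_continuous_on: "C1_on f S \<Longrightarrow> continuous_on S f"
  unfolding C1_on_def by (meson DERIV_continuous continuous_on_eq_continuous_within)

text \<open>A primitive of an increasing function is convex. The mean value theorem gives a slope
  \<open>f c\<close> at an intermediate point, and monotonicity compares it with \<open>f x\<close>
  on either side.\<close>

lemma primitive_above_tangent:
  fixes G f :: "real \<Rightarrow> real"
  assumes G: "\<And>x. x \<in> {0..1} \<Longrightarrow> (G has_real_derivative f x) (at x within {0..1})"
    and mono: "\<And>x y. x \<in> {0..1} \<Longrightarrow> y \<in> {0..1} \<Longrightarrow> x \<le> y \<Longrightarrow> f x \<le> f y"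
    and x: "x \<in> {0..1}" and y: "y \<in> {0..1}"
  shows "G x + f x * (y - x) \<le> G y"
proof -
  have mvt: "\<exists>c\<in>{a<..<b}. G b - G a = f c * (b - a)"
    if "a < b" "a \<in> {0..1}" "b \<in> {0..1}" for a b
  proof (rule mvt_simple[OF \<open>a < b\<close>])
    fix t assume "a \<le> t" "t \<le> b"
    thus "(G has_derivative (*) (f t)) (at t within {a..b})"
      using G[of t] that has_field_derivative_subset[of G "f t" t "{0..1}" "{a..b}"]
      by (auto simp: has_field_derivative_def)
  qed
  consider "x < y" | "x = y" | "y < x" by linarith
  thus ?thesis
  proof cases
    case 1
    then obtain c where "c \<in> {x<..<y}" "G y - G x = f c * (y - x)" using mvt[OF 1 x y] by blast
    moreover have "f x * (y - x) \<le> f c * (y - x)"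
      using calculation x y by (intro mult_right_mono mono) auto
    ultimately show ?thesis by linarith
  next
    case 3
    then obtain c where "c \<in> {y<..<x}" "G x - G y = f c * (x - y)" using mvt[OF 3 y x] by blast
    moreover have "f c * (x - y) \<le> f x * (x - y)"
      using calculation x y by (intro mult_right_mono mono) auto
    ultimately show ?thesis by (simp only: algebra_simps)
  qed simp
qed

text \<open>The gradient is minus \<open>F_field\<close> when \<open>G\<close> is a primitive of
  \<open>f\<close>. The factor \<open>CARD('n)\<close> offsets the derivative
  \<open>1 / CARD('n)\<close> of the mean with respect to one component.\<close>

definition potential ::
    "real \<Rightarrow> real \<Rightarrow> real \<Rightarrow> (real \<Rightarrow> real) \<Rightarrow> real ^ 'n::finite \<Rightarrow> real" where
  "potential \<alpha> \<beta> q G z =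
     (\<Sum>h\<in>UNIV. (z $ h)^2 / 2 - \<beta> * q * z $ h - (1 - \<alpha> - \<beta>) * G (z $ h))
     - \<alpha> * real CARD('n) / 2 * (mean (\<lambda>i. z $ i))^2"

lemma sum_eq_mean: "(\<Sum>i\<in>UNIV. x i) = real CARD('n) * mean (x :: 'n::finite \<Rightarrow> real)"
  by (simp add: mean_def)

lemma mean_bounds:
  fixes x :: "'n::finite \<Rightarrow> real"
  assumes "\<And>i. a \<le> x i" "\<And>i. x i \<le> b"
  shows "a \<le> mean x" "mean x \<le> b"
  using sum_bounded_below[of UNIV a x] sum_bounded_above[of UNIV x b] assms
  by (auto simp: mean_def field_simps)

lemma inner_vec_sum: "(x :: real ^ 'n) \<bullet> y = (\<Sum>i\<in>UNIV. x $ i * y $ i)"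
  by (simp add: inner_vec_def)

text \<open>The potential is half the squared norm minus a convex function, so it satisfies the descent
  inequality without any smoothness beyond \<open>G' = f\<close>.\<close>

lemma potential_descent:
  fixes x y :: "real ^ 'n::finite"
  assumes G: "\<And>s t. s \<in> {0..1} \<Longrightarrow> t \<in> {0..1} \<Longrightarrow> G s + f s * (t - s) \<le> G t"
    and x: "\<And>h. x $ h \<in> {0..1}" and y: "\<And>h. y $ h \<in> {0..1}"
    and "0 \<le> \<alpha>" "\<alpha> + \<beta> \<le> 1"
  shows "potential \<alpha> \<beta> q G y
    \<le> potential \<alpha> \<beta> q G x - F_field \<alpha> \<beta> q f x \<bullet> (y - x) + (norm (y - x))^2 / 2"
proof -
  define N where "N = real CARD('n)"
  define mx my where "mx = mean (\<lambda>i. x $ i)" and "my = mean (\<lambda>i. y $ i)"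
  define u where "u t = t^2 / 2 - \<beta> * q * t - (1 - \<alpha> - \<beta>) * G t" for t
  \<comment> \<open>The quadratic part expands exactly, so the tangent inequality for
    \<open>G\<close> is the only loss. The term with \<open>\<alpha> * mx\<close> is added back
    because \<open>F_field\<close> contains the coupling while \<open>u\<close> does not.\<close>
  have comp: "u (y $ h) \<le> u (x $ h) - F_field \<alpha> \<beta> q f x $ h * (y $ h - x $ h)
      + \<alpha> * mx * (y $ h - x $ h) + (y $ h - x $ h)^2 / 2" for h
  proof -
    have "(1 - \<alpha> - \<beta>) * (G (x $ h) + f (x $ h) * (y $ h - x $ h)) \<le> (1 - \<alpha> - \<beta>) * G (y $ h)"
      using assms(5) by (intro mult_left_mono G x y) auto
    moreover have "u (x $ h) - F_field \<alpha> \<beta> q f x $ h * (y $ h - x $ h)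
          + \<alpha> * mx * (y $ h - x $ h) + (y $ h - x $ h)^2 / 2 - u (y $ h)
        = (1 - \<alpha> - \<beta>) * G (y $ h) - (1 - \<alpha> - \<beta>) * (G (x $ h) + f (x $ h) * (y $ h - x $ h))"
      by (simp add: u_def F_field_def mx_def power2_eq_square field_simps)
    ultimately show ?thesis by linarith
  qed
  have "(\<Sum>h\<in>UNIV. u (y $ h)) \<le> (\<Sum>h\<in>UNIV. u (x $ h) - F_field \<alpha> \<beta> q f x $ h * (y $ h - x $ h)
      + \<alpha> * mx * (y $ h - x $ h) + (y $ h - x $ h)^2 / 2)"
    by (intro sum_mono comp)
  also have "\<dots> = (\<Sum>h\<in>UNIV. u (x $ h)) - F_field \<alpha> \<beta> q f x \<bullet> (y - x)
      + \<alpha> * mx * (N * (my - mx)) + (norm (y - x))^2 / 2"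
  proof -
    have "(norm (y - x))^2 = (\<Sum>h\<in>UNIV. (y $ h - x $ h)^2)"
      unfolding power2_norm_eq_inner inner_vec_sum by (simp add: power2_eq_square)
    moreover have "(\<Sum>h\<in>UNIV. y $ h - x $ h) = N * (my - mx)"
      by (simp add: sum_subtractf sum_eq_mean N_def mx_def my_def right_diff_distrib)
    ultimately show ?thesis
      by (simp add: sum.distrib sum_subtractf inner_vec_sum sum_distrib_left[symmetric]
          sum_divide_distrib[symmetric])
  qed
  finally have "(\<Sum>h\<in>UNIV. u (y $ h)) \<le> \<dots>" .
  \<comment> \<open>This square is twice the gap left by linearising the squared-mean term at
    \<open>mx\<close>; its sign is the convexity of that term.\<close>
  moreover have "0 \<le> \<alpha> * N * (my - mx)^2" using assms(4) by (simp add: N_def)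
  ultimately show ?thesis
    unfolding potential_def u_def[symmetric] mx_def[symmetric] my_def[symmetric] N_def[symmetric]
    by (simp add: power2_eq_square algebra_simps)
qed

lemma summable_vec_componentwise:
  fixes e :: "nat \<Rightarrow> real ^ 'n"
  assumes "\<And>h. summable (\<lambda>n. e n $ h)"
  shows "summable e"
proof -
  have "summable (\<lambda>n. \<Sum>h\<in>UNIV. (e n $ h) *\<^sub>R (axis h 1 :: real ^ 'n))"
    using assms by (intro summable_sum summable_scaleR_left)
  moreover have "(\<Sum>h\<in>UNIV. (e n $ h) *\<^sub>R axis h 1) = e n" for n
    using basis_expansion[of "e n"] by (simp add: scalar_mult_eq_scaleR)
  ultimately show ?thesis by simp
qed

lemma continuous_on_F_field:
  assumes "continuous_on {0..1} f"
  shows "continuous_on (cbox 0 1) (F_field \<alpha> \<beta> q f :: real ^ 'n \<Rightarrow> real ^ 'n)"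
  unfolding F_field_def mean_def
  by (intro continuous_on_vec_lambda continuous_intros continuous_on_compose2[OF assms])
     (auto simp: mem_box_cart)

lemma zeros_F_diagonal:
  fixes z :: "real ^ 'n"
  assumes \<alpha>: "0 \<le> \<alpha>" and \<beta>: "0 \<le> \<beta>" and sum: "0 < \<alpha> + \<beta>" "\<alpha> + \<beta> < 1"
    and q: "0 < q" "q \<le> 1"
    and unique: "\<And>c. c \<in> {- ((\<alpha> + \<beta>) / (1 - \<alpha> - \<beta>)) <..< 0} \<Longrightarrow>
           (\<exists>\<^sub>\<le>\<^sub>1 z. z \<in> {0..1} \<and> phi_tilde \<alpha> \<beta> f c z = 0)"
    and endpoint: "\<alpha> = 0 \<Longrightarrow> q = 1 \<Longrightarrow>
           (\<exists>\<^sub>\<le>\<^sub>1 z. z \<in> {0..1} \<and> phi_tilde \<alpha> \<beta> f (- ((\<alpha> + \<beta>) / (1 - \<alpha> - \<beta>))) z = 0)"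
    and z: "z \<in> zeros_F \<alpha> \<beta> q f"
  shows "\<exists>c. z = c *\<^sub>R 1"
proof -
  define m where "m = mean (\<lambda>i. z $ i)"
  define s where "s = \<alpha> * m + \<beta> * q"
  define c where "c = - (s / (1 - \<alpha> - \<beta>))"
  have z01: "0 \<le> z $ h" "z $ h \<le> 1" for h using z by (auto simp: zeros_F_def)
  have m: "0 \<le> m" "m \<le> 1" unfolding m_def using z01 by (auto intro!: mean_bounds)
  have D: "1 - \<alpha> - \<beta> \<noteq> 0" using sum by simp
  have eq: "s + (1 - \<alpha> - \<beta>) * f (z $ h) - z $ h = 0" for h
    using z by (auto simp: zeros_F_def F_field_def vec_eq_iff s_def m_def)
  hence root: "phi_tilde \<alpha> \<beta> f c (z $ h) = 0" for h
  proof -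
    have "phi_tilde \<alpha> \<beta> f c (z $ h) = (s + (1 - \<alpha> - \<beta>) * f (z $ h) - z $ h) / (1 - \<alpha> - \<beta>)"
      using D by (simp add: phi_tilde_def c_def add_divide_distrib diff_divide_distrib)
    thus ?thesis using eq by simp
  qed
  have s_bounds: "0 \<le> \<alpha> * m" "0 \<le> \<beta> * q" "\<alpha> * m \<le> \<alpha>" "\<beta> * q \<le> \<beta>"
    using \<alpha> \<beta> m q by (auto intro: mult_left_le)
  have const: "\<exists>a. \<forall>h. z $ h = a" if "\<exists>\<^sub>\<le>\<^sub>1 z. z \<in> {0..1} \<and> phi_tilde \<alpha> \<beta> f c z = 0"
  proof (intro exI allI)
    \<comment> \<open>\<open>undefined\<close> serves as an arbitrary reference component.\<close>
    show "z $ h = z $ undefined" for h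
      by (rule Uniq_D[OF that]) (simp_all add: root z01)
  qed
  have "\<exists>a. \<forall>h. z $ h = a"
  proof -
    \<comment> \<open>\<open>s\<close> ranges over the closed interval from 0 to
      \<open>\<alpha> + \<beta>\<close>, and its interior matches the open interval for
      \<open>c\<close>. At the ends both summands of \<open>s\<close> are extremal: this forces mean
      0 or 1, hence a constant vector, unless \<open>\<alpha> = 0\<close> at the upper end, where
      \<open>q = 1\<close> follows and \<open>endpoint\<close> applies.\<close>
    consider "0 < s" "s < \<alpha> + \<beta>" | "s = 0" | "s = \<alpha> + \<beta>" "\<alpha> = 0" | "s = \<alpha> + \<beta>" "0 < \<alpha>"
    proof -
      have "0 < s \<and> s < \<alpha> + \<beta> \<or> s = 0 \<or> s = \<alpha> + \<beta>" "\<alpha> = 0 \<or> 0 < \<alpha>"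
        using s_bounds \<alpha> unfolding s_def by linarith+
      thus thesis using that by blast
    qed
    thus ?thesis
    proof cases
      case 1
      have "c \<in> {- ((\<alpha> + \<beta>) / (1 - \<alpha> - \<beta>)) <..< 0}"
        using 1 sum by (auto simp: c_def divide_strict_right_mono)
      thus ?thesis by (intro const unique)
    next
      case 2
      hence "\<beta> * q = 0" "\<alpha> * m = 0" using s_bounds unfolding s_def by linarith+
      hence "m = 0" using q sum by auto
      hence "(\<Sum>i\<in>UNIV. z $ i) = 0" by (simp add: m_def mean_def)
      hence "\<forall>h. z $ h = 0" using z01 by (simp add: sum_nonneg_eq_0_iff)
      thus ?thesis by blast
    next
      case 3
      hence "q = 1" using sum by (auto simp: s_def)
      from endpoint[OF 3(2) this] show ?thesis
        by (intro const) (simp add: c_def 3(1))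
    next
      case 4
      hence "\<alpha> * m = \<alpha>" using s_bounds unfolding s_def by linarith
      hence "m = 1" using 4 by simp
      hence "(\<Sum>i\<in>UNIV. 1 - z $ i) = 0" by (simp add: sum_subtractf sum_eq_mean m_def)
      hence "\<forall>h. 1 - z $ h = 0" using z01 by (subst (asm) sum_nonneg_eq_0_iff) auto
      thus ?thesis by auto
    qed
  qed
  thus ?thesis by (auto simp: vec_eq_iff)
qed

section \<open>The random process: noise, measurability, and the almost sure vanishing of the
  field\<close>

context interacting_reinforced
begin

definition state :: "nat \<Rightarrow> 'a \<Rightarrow> real ^ 'n" where
  "state n \<omega> = (\<chi> h. Z n h \<omega>)"

definition drift :: "nat \<Rightarrow> 'n \<Rightarrow> 'a \<Rightarrow> real" where
  "drift n h \<omega> = \<alpha> * mean (\<lambda>i. Z n i \<omega>) + \<beta> * q + (1 - \<alpha> - \<beta>) * f (Z n h \<omega>)"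

text \<open>The martingale difference of the step from \<open>n\<close> to \<open>n + 1\<close>; it
  is known only from \<open>history\<close> at time \<open>n + 1\<close> on.\<close>

definition noise :: "nat \<Rightarrow> 'n \<Rightarrow> 'a \<Rightarrow> real" where
  "noise n h \<omega> = I (Suc n) h \<omega> - drift n h \<omega>"

abbreviation vfield :: "real ^ 'n \<Rightarrow> real ^ 'n" where
  "vfield \<equiv> F_field \<alpha> \<beta> q f"

lemma state_nth [simp]: "state n \<omega> $ h = Z n h \<omega>"
  by (simp add: state_def)

lemma vfield_state: "vfield (state n \<omega>) $ h = drift n h \<omega> - Z n h \<omega>"
  by (simp add: F_field_def state_def drift_def)

lemma f_continuous: "continuous_on {0..1} f"
  using f_C1 by (rule C1_on_imp_continuous_on)

lemma Z_range: "\<omega> \<in> space M \<Longrightarrow> Z n h \<omega> \<in> {0..1}"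
proof (induction n)
  case (Suc n)
  have r: "0 \<le> r n" "r n \<le> 1" using r_range[of n] by auto
  have "0 \<le> (1 - r n) * Z n h \<omega>" "(1 - r n) * Z n h \<omega> \<le> 1 - r n"
    using Suc r by (auto intro: mult_left_le)
  moreover have "0 \<le> r n * I (Suc n) h \<omega>" "r n * I (Suc n) h \<omega> \<le> r n"
    using I_range[OF Suc.prems, of n h] r by auto
  ultimately show ?case using Suc.prems by (simp add: Z_Suc)
qed (rule Z0_range)

lemma drift_range: assumes "\<omega> \<in> space M" shows "drift n h \<omega> \<in> {0..1}"
proof -
  have "0 \<le> mean (\<lambda>i. Z n i \<omega>)" "mean (\<lambda>i. Z n i \<omega>) \<le> 1"
    using Z_range[OF assms, of n] by (auto intro!: mean_bounds)
  moreover have "f (Z n h \<omega>) \<in> {0..1}" using f_range Z_range[OF assms] by blast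
  ultimately have "0 \<le> \<alpha> * mean (\<lambda>i. Z n i \<omega>)" "\<alpha> * mean (\<lambda>i. Z n i \<omega>) \<le> \<alpha>"
    "0 \<le> \<beta> * q" "\<beta> * q \<le> \<beta>"
    "0 \<le> (1 - \<alpha> - \<beta>) * f (Z n h \<omega>)" "(1 - \<alpha> - \<beta>) * f (Z n h \<omega>) \<le> 1 - \<alpha> - \<beta>"
    using \<alpha>_range \<beta>_range \<alpha>\<beta>_range q_range by (auto intro: mult_left_le)
  thus ?thesis by (simp add: drift_def)
qed

lemma I_bounds: "\<omega> \<in> space M \<Longrightarrow> 0 \<le> I (Suc n) h \<omega> \<and> I (Suc n) h \<omega> \<le> 1"
  using I_range[of \<omega> n h] by auto

lemma noise_bound: "\<omega> \<in> space M \<Longrightarrow> \<bar>noise n h \<omega>\<bar> \<le> 1"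
  using I_bounds[of \<omega> n h] drift_range[of \<omega> n h] by (auto simp: noise_def abs_le_iff)

lemma vfield_state_bound: "\<omega> \<in> space M \<Longrightarrow> \<bar>vfield (state n \<omega>) $ h\<bar> \<le> 1"
  using drift_range[of \<omega> n h] Z_range[of \<omega> n h] by (auto simp: vfield_state abs_le_iff)

lemma space_history [simp]: "space (history M Z I n) = space M"
  unfolding history_def by (rule space_measure_of) auto

lemma subalgebra_history: "subalgebra M (history M Z I n)"
proof -
  let ?E = "{Z 0 h -` A \<inter> space M | h A. A \<in> sets borel} \<union>
      {I k h -` A \<inter> space M | k h A. 1 \<le> k \<and> k \<le> n \<and> A \<in> sets borel}"
  have "?E \<subseteq> sets M"
  proof (intro Un_least subsetI; clarify)
    fix k :: nat and h and A :: "real set" assume "1 \<le> k" "A \<in> sets borel"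
    thus "I k h -` A \<inter> space M \<in> sets M"
      using I_measurable[of "k - 1" h] by (auto intro: measurable_sets)
  qed (auto intro: measurable_sets[OF Z0_measurable])
  hence "sigma_sets (space M) ?E \<subseteq> sets M" by (rule sets.sigma_sets_subset)
  moreover have "sets (history M Z I n) = sigma_sets (space M) ?E"
    unfolding history_def by (rule sets_measure_of) auto
  ultimately show ?thesis by (simp add: subalgebra_def)
qed

lemma I_history:
  assumes "k < n" shows "I (Suc k) h \<in> borel_measurable (history M Z I n)"
proof (rule measurableI)
  fix A :: "real set" assume A: "A \<in> sets borel"
  have "1 \<le> Suc k \<and> Suc k \<le> n \<and> A \<in> sets borel" using assms A by auto
  hence "I (Suc k) h -` A \<inter> space M \<in>
      {I k h -` A \<inter> space M | k h A. 1 \<le> k \<and> k \<le> n \<and> A \<in> sets borel}" by blast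
  thus "I (Suc k) h -` A \<inter> space (history M Z I n) \<in> sets (history M Z I n)"
    unfolding space_history by (subst history_def, intro in_measure_of UnI2) auto
qed simp

lemma Z_history: "m \<le> n \<Longrightarrow> Z m h \<in> borel_measurable (history M Z I n)"
proof (induction m)
  case 0
  show ?case
  proof (rule measurableI)
    fix A :: "real set" assume "A \<in> sets borel"
    hence "Z 0 h -` A \<inter> space M \<in> {Z 0 h -` A \<inter> space M | h A. A \<in> sets borel}" by blast
    thus "Z 0 h -` A \<inter> space (history M Z I n) \<in> sets (history M Z I n)"
      unfolding space_history by (subst history_def, intro in_measure_of UnI1) auto
  qed simp
next
  case (Suc m)
  have [measurable]: "Z m h \<in> borel_measurable (history M Z I n)"
    "I (Suc m) h \<in> borel_measurable (history M Z I n)"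
    using Suc by (auto intro: I_history)
  have "(\<lambda>\<omega>. (1 - r m) * Z m h \<omega> + r m * I (Suc m) h \<omega>) \<in> borel_measurable (history M Z I n)"
    by measurable
  thus ?case by (subst measurable_cong[OF Z_Suc]) auto
qed

lemma drift_history:
  assumes "m \<le> n" shows "drift m h \<in> borel_measurable (history M Z I n)"
proof -
  have [measurable]: "Z m i \<in> borel_measurable (history M Z I n)" for i
    using assms by (rule Z_history)
  \<comment> \<open>Outside the unit interval \<open>f\<close> is arbitrary, so measurability is
    shown for its truncation, which agrees with \<open>f\<close> at all values of
    \<open>Z\<close>.\<close>
  have [measurable]: "(\<lambda>x. indicator {0..1} x *\<^sub>R f x) \<in> borel_measurable borel"
    by (intro borel_measurable_continuous_on_indicator f_continuous) auto
  have "(\<lambda>\<omega>. indicator {0..1} (Z m h \<omega>) *\<^sub>R f (Z m h \<omega>)) \<in> borel_measurable (history M Z I n)"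
    by measurable
  also have "?this \<longleftrightarrow> (\<lambda>\<omega>. f (Z m h \<omega>)) \<in> borel_measurable (history M Z I n)"
    by (intro measurable_cong) (use Z_range in auto)
  finally show ?thesis unfolding drift_def[abs_def] mean_def
    by (intro borel_measurable_add borel_measurable_times borel_measurable_sum borel_measurable_const) auto
qed

lemma noise_history:
  assumes "m < n" shows "noise m h \<in> borel_measurable (history M Z I n)"
  unfolding noise_def[abs_def] using assms
  by (intro borel_measurable_diff I_history drift_history) auto

lemma history_imp_measurable:
  "W \<in> borel_measurable (history M Z I n) \<Longrightarrow> W \<in> borel_measurable M"
  by (rule measurable_from_subalg[OF subalgebra_history])

text \<open>\<open>I (Suc n) h\<close> is the indicator of an event whose conditional probability is
  the drift. The factor \<open>W\<close> belongs to the past, so under the integral the indicator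
  may be replaced by that conditional probability.\<close>

lemma noise_orthogonal:
  assumes W: "W \<in> borel_measurable (history M Z I n)"
    and bound: "\<And>\<omega>. \<omega> \<in> space M \<Longrightarrow> \<bar>W \<omega>\<bar> \<le> B"
  shows "expectation (\<lambda>\<omega>. W \<omega> * noise n h \<omega>) = 0"
proof -
  interpret H: finite_measure_subalgebra M "history M Z I n"
    by unfold_locales (rule subalgebra_history)
  define A where "A = {\<omega> \<in> space M. I (Suc n) h \<omega> = 1}"
  have [measurable]: "W \<in> borel_measurable M" "I (Suc n) h \<in> borel_measurable M"
      "drift n h \<in> borel_measurable M"
    using W I_measurable drift_history[of n n] by (auto intro: history_imp_measurable)
  have [measurable]: "A \<in> sets M" unfolding A_def by measurable
  have ind: "I (Suc n) h \<omega> = indicator A \<omega>" if "\<omega> \<in> space M" for \<omega>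
    using I_range[OF that, of n h] that by (auto simp: A_def indicator_def)
  have int: "integrable M (\<lambda>\<omega>. W \<omega> * Y \<omega>)"
    if [measurable]: "Y \<in> borel_measurable M" and "\<And>\<omega>. \<omega> \<in> space M \<Longrightarrow> \<bar>Y \<omega>\<bar> \<le> 1" for Y
    using that(2) bound
    by (intro integrable_const_bound[where B = "B * 1"])
       (auto simp: abs_mult simp del: mult_1_right intro!: mult_mono order_trans[OF abs_ge_zero bound])
  have intI: "integrable M (\<lambda>\<omega>. W \<omega> * I (Suc n) h \<omega>)"
    and intd: "integrable M (\<lambda>\<omega>. W \<omega> * drift n h \<omega>)"
    and intA: "integrable M (\<lambda>\<omega>. W \<omega> * indicator A \<omega>)"
    using I_bounds drift_range by (auto intro!: int simp: indicator_def)
  have "expectation (\<lambda>\<omega>. W \<omega> * I (Suc n) h \<omega>) = expectation (\<lambda>\<omega>. W \<omega> * indicator A \<omega>)"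
    by (intro Bochner_Integration.integral_cong) (simp_all add: ind)
  also have "\<dots> = expectation (\<lambda>\<omega>. W \<omega> * real_cond_exp M (history M Z I n) (indicator A) \<omega>)"
    by (rule H.real_cond_exp_intg(2)[symmetric]) (use intA W in auto)
  also have "\<dots> = expectation (\<lambda>\<omega>. W \<omega> * drift n h \<omega>)"
  proof (rule integral_cong_AE)
    show "AE \<omega> in M. W \<omega> * real_cond_exp M (history M Z I n) (indicator A) \<omega> = W \<omega> * drift n h \<omega>"
      using I_cond_prob[of n h] unfolding cond_prob_on_def A_def[symmetric] drift_def
      by eventually_elim simp
  qed measurable
  finally show ?thesis
    using intI intd by (simp add: noise_def right_diff_distrib)
qed

lemma r_nonneg: "0 \<le> r n" and r_le_1: "r n \<le> 1"
  using r_range[of n] by auto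

text \<open>Weights known at time \<open>n\<close> keep the increments orthogonal. The weight 1
  yields the noise itself, and a component of the field yields the error term in the energy
  balance.\<close>

lemma AE_summable_noise:
  assumes W: "\<And>m n. m \<le> n \<Longrightarrow> W m \<in> borel_measurable (history M Z I n)"
    and bound: "\<And>n \<omega>. \<omega> \<in> space M \<Longrightarrow> \<bar>W n \<omega>\<bar> \<le> 1"
  shows "AE \<omega> in M. summable (\<lambda>n. r n * (W n \<omega> * noise n h \<omega>))"
proof -
  obtain C where C: "\<And>n. r n \<le> C / real (Suc n)"
    using harmonic_steps_bound[OF r_nonneg r_lim] by blast
  have meas: "(\<lambda>\<omega>. r m * (W m \<omega> * noise m h \<omega>)) \<in> borel_measurable (history M Z I n)" if "m < n" for m n
    using W[of m n] noise_history[OF that, of h] that by (intro borel_measurable_times) auto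
  have bd1: "\<bar>W n \<omega> * noise n h \<omega>\<bar> \<le> 1" if "\<omega> \<in> space M" for n \<omega>
    using mult_mono[OF bound[OF that, of n] noise_bound[OF that, of n h]] by (simp add: abs_mult)
  have bd: "\<bar>r n * (W n \<omega> * noise n h \<omega>)\<bar> \<le> r n" if "\<omega> \<in> space M" for n \<omega>
    using mult_left_mono[OF bd1[OF that, of n] r_nonneg[of n]] r_nonneg[of n] by (simp add: abs_mult)
  show ?thesis
  proof (rule AE_summable_orthogonal)
    show "(\<lambda>\<omega>. r n * (W n \<omega> * noise n h \<omega>)) \<in> borel_measurable M" for n
      using meas[of n "Suc n"] by (auto intro: history_imp_measurable)
    show "\<bar>r n * (W n \<omega> * noise n h \<omega>)\<bar> \<le> C / real (Suc n)" if "\<omega> \<in> space M" for n \<omega>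
      using bd[OF that, of n] C[of n] by (rule order_trans)
    fix m n :: nat assume "m < n"
    \<comment> \<open>The whole earlier increment times the current weight \<open>W n\<close> is
      determined by the history at time \<open>n\<close>, hence orthogonal to
      \<open>noise n h\<close>.\<close>
    have "expectation (\<lambda>\<omega>. (r m * (W m \<omega> * noise m h \<omega>)) * W n \<omega> * noise n h \<omega>) = 0"
    proof (rule noise_orthogonal)
      show "(\<lambda>\<omega>. (r m * (W m \<omega> * noise m h \<omega>)) * W n \<omega>) \<in> borel_measurable (history M Z I n)"
        by (rule borel_measurable_times[OF meas[OF \<open>m < n\<close>] W]) simp
      show "\<bar>(r m * (W m \<omega> * noise m h \<omega>)) * W n \<omega>\<bar> \<le> 1 * 1" if "\<omega> \<in> space M" for \<omega>
        unfolding abs_mult[of "r m * (W m \<omega> * noise m h \<omega>)"]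
        using bd[OF that, of m] r_le_1[of m] bound[OF that, of n] by (intro mult_mono) auto
    qed
    hence "r n * expectation (\<lambda>\<omega>. (r m * (W m \<omega> * noise m h \<omega>)) * W n \<omega> * noise n h \<omega>) = 0" by simp
    thus "expectation (\<lambda>\<omega>. (r m * (W m \<omega> * noise m h \<omega>)) * (r n * (W n \<omega> * noise n h \<omega>))) = 0"
      by (simp flip: integral_mult_right_zero add: ac_simps)
  qed
qed

lemma state_in_cbox: "\<omega> \<in> space M \<Longrightarrow> state n \<omega> \<in> cbox 0 1"
  using Z_range[of \<omega>] by (auto simp: mem_box_cart state_def)

lemma state_step:
  assumes "\<omega> \<in> space M"
  shows "state (Suc n) \<omega> - state n \<omega> = r n *\<^sub>R (vfield (state n \<omega>) + (\<chi> h. noise n h \<omega>))"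
  using assms by (simp add: vec_eq_iff vfield_state noise_def Z_Suc algebra_simps)

lemma norm_state_step:
  assumes "\<omega> \<in> space M"
  shows "(norm (state (Suc n) \<omega> - state n \<omega>))^2 \<le> real CARD('n) * (r n)^2"
proof -
  have "(norm (state (Suc n) \<omega> - state n \<omega>))^2 = (\<Sum>h\<in>UNIV. (r n * (I (Suc n) h \<omega> - Z n h \<omega>))^2)"
    unfolding power2_norm_eq_inner inner_vec_sum
    using assms by (simp add: state_def Z_Suc power2_eq_square algebra_simps)
  also have "\<dots> \<le> of_nat (card (UNIV :: 'n set)) * (r n)^2"
  proof (rule sum_bounded_above)
    fix h
    have "\<bar>I (Suc n) h \<omega> - Z n h \<omega>\<bar> \<le> 1"
      using I_bounds[OF assms, of n h] Z_range[OF assms, of n h] by (auto simp: abs_le_iff)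
    hence "(I (Suc n) h \<omega> - Z n h \<omega>)^2 \<le> 1" by (simp add: abs_square_le_1)
    thus "(r n * (I (Suc n) h \<omega> - Z n h \<omega>))^2 \<le> (r n)^2"
      unfolding power_mult_distrib by (rule mult_left_le) simp
  qed
  finally show ?thesis by simp
qed

lemma state_steps_tendsto_0:
  assumes "\<omega> \<in> space M"
  shows "(\<lambda>n. dist (state (Suc n) \<omega>) (state n \<omega>)) \<longlonglongrightarrow> 0"
proof -
  have "(\<lambda>n. real CARD('n) * (r n)^2) \<longlonglongrightarrow> real CARD('n) * 0^2"
    by (intro tendsto_intros harmonic_steps_tendsto_0[OF r_nonneg r_lim])
  hence lim: "(\<lambda>n. real CARD('n) * (r n)^2) \<longlonglongrightarrow> 0" by simp
  have "(\<lambda>n. (norm (state (Suc n) \<omega> - state n \<omega>))^2) \<longlonglongrightarrow> 0"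
    by (rule tendsto_sandwich[OF _ _ tendsto_const lim])
       (intro always_eventually allI zero_le_power2 norm_state_step assms)+
  hence "(\<lambda>n. sqrt ((norm (state (Suc n) \<omega> - state n \<omega>))^2)) \<longlonglongrightarrow> sqrt 0"
    by (rule tendsto_real_sqrt)
  thus ?thesis by (simp add: dist_norm)
qed

text \<open>The descent inequality is applied to consecutive states. Its inner product splits into
  the energy and the correlation of field and noise, and its quadratic term is
  \<open>O((r n)^2)\<close>.\<close>

lemma summable_energy:
  assumes G: "\<And>x. x \<in> {0..1} \<Longrightarrow> (G has_real_derivative f x) (at x within {0..1})"
    and \<omega>: "\<omega> \<in> space M"
    and corr: "\<And>h. summable (\<lambda>n. r n * (vfield (state n \<omega>) $ h * noise n h \<omega>))"
  shows "summable (\<lambda>n. r n * (norm (vfield (state n \<omega>)))^2)"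
proof (rule summable_of_descent)
  have mono: "f x \<le> f y" if "x \<in> {0..1}" "y \<in> {0..1}" "x \<le> y" for x y
    using strict_mono_on_leD[OF f_strict_mono that] .
  note tangent = primitive_above_tangent[OF G mono]
  define V where "V n = potential \<alpha> \<beta> q G (state n \<omega>)" for n
  have st: "state n \<omega> $ h \<in> {0..1}" for n h using Z_range[OF \<omega>] by (simp add: state_def)
  have par: "0 \<le> \<alpha>" "\<alpha> + \<beta> \<le> 1" using \<alpha>_range \<alpha>\<beta>_range by auto
  note descent = potential_descent[OF tangent, where \<alpha> = \<alpha> and \<beta> = \<beta> and q = q]
  show "V (Suc n) \<le> V n - r n * (norm (vfield (state n \<omega>)))^2
      - (\<Sum>h\<in>UNIV. r n * (vfield (state n \<omega>) $ h * noise n h \<omega>))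
      + real CARD('n) / 2 * (r n)^2" for n
  proof -
    have "vfield (state n \<omega>) \<bullet> (state (Suc n) \<omega> - state n \<omega>)
        = r n * (norm (vfield (state n \<omega>)))^2
          + (\<Sum>h\<in>UNIV. r n * (vfield (state n \<omega>) $ h * noise n h \<omega>))"
      unfolding state_step[OF \<omega>]
      by (simp add: inner_add_right distrib_left power2_norm_eq_inner inner_vec_sum[of _ "\<chi> h. noise n h \<omega>"]
          sum_distrib_left)
    thus ?thesis
      using descent[of "state n \<omega>" "state (Suc n) \<omega>"] st par norm_state_step[OF \<omega>, of n]
      by (auto simp: V_def)
  qed
  \<comment> \<open>The lower bound comes from the descent inequality towards the origin: the inner
    product costs at most \<open>CARD('n)\<close> and the quadratic term half of that, together less
    than \<open>2 * CARD('n)\<close>.\<close>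
  show "potential \<alpha> \<beta> q G (0 :: real ^ 'n) - 2 * real CARD('n) \<le> V n" for n
  proof -
    have "vfield (state n \<omega>) \<bullet> state n \<omega> \<le> real CARD('n) * 1" unfolding inner_vec_sum
    proof (rule sum_bounded_above[of UNIV, simplified])
      fix h
      have "\<bar>vfield (state n \<omega>) $ h\<bar> * \<bar>state n \<omega> $ h\<bar> \<le> 1 * 1"
        using vfield_state_bound[OF \<omega>, of n h] st[of n h] by (intro mult_mono) auto
      thus "vfield (state n \<omega>) $ h * state n \<omega> $ h \<le> 1" by (simp flip: abs_mult)
    qed
    moreover have "(norm (state n \<omega>))^2 \<le> real CARD('n) * 1"
      unfolding power2_norm_eq_inner inner_vec_sum
    proof (rule sum_bounded_above[of UNIV, simplified])
      fix h show "state n \<omega> $ h * state n \<omega> $ h \<le> 1" using st[of n h] by (simp add: mult_le_one)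
    qed
    ultimately show ?thesis
      using descent[of "state n \<omega>" 0] st par by (simp add: V_def)
  qed
  show "summable (\<lambda>n. real CARD('n) / 2 * (r n)^2)"
    by (intro summable_mult harmonic_steps_square_summable[OF r_nonneg r_lim])
  show "summable (\<lambda>n. \<Sum>h\<in>UNIV. r n * (vfield (state n \<omega>) $ h * noise n h \<omega>))"
    by (intro summable_sum corr)
qed (simp add: r_nonneg)

lemma vfield_state_tendsto_0:
  assumes G: "\<And>x. x \<in> {0..1} \<Longrightarrow> (G has_real_derivative f x) (at x within {0..1})"
    and \<omega>: "\<omega> \<in> space M"
    and noise: "\<And>h. summable (\<lambda>n. r n * noise n h \<omega>)"
    and corr: "\<And>h. summable (\<lambda>n. r n * (vfield (state n \<omega>) $ h * noise n h \<omega>))"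
  shows "(\<lambda>n. vfield (state n \<omega>)) \<longlonglongrightarrow> 0"
proof (rule drift_tendsto_0[where F = vfield and z = "\<lambda>n. state n \<omega>" and K = "cbox 0 1"
      and e = "\<lambda>n. r n *\<^sub>R (\<chi> h. noise n h \<omega>)",
      OF r_nonneg r_le_1 harmonic_steps_not_summable[OF r_nonneg r_lim]])
  show "uniformly_continuous_on (cbox 0 1) vfield"
    by (intro compact_uniformly_continuous continuous_on_F_field f_continuous compact_cbox)
  show "norm (state (Suc n) \<omega> - state n \<omega> - r n *\<^sub>R (\<chi> h. noise n h \<omega>))
      \<le> r n * norm (vfield (state n \<omega>))" for n
    unfolding state_step[OF \<omega>] by (simp add: scaleR_add_right r_nonneg)
  show "summable (\<lambda>n. r n *\<^sub>R (\<chi> h. noise n h \<omega>))"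
    by (rule summable_vec_componentwise) (simp add: noise)
qed (use state_in_cbox[OF \<omega>] summable_energy[OF G \<omega> corr] in auto)

lemma AE_vfield_state_tendsto_0:
  assumes "has_primitive_on f {0..1}"
  shows "AE \<omega> in M. (\<lambda>n. vfield (state n \<omega>)) \<longlonglongrightarrow> 0"
proof -
  obtain G where G: "\<And>x. x \<in> {0..1} \<Longrightarrow> (G has_real_derivative f x) (at x within {0..1})"
    using assms unfolding has_primitive_on_def by blast
  have "AE \<omega> in M. summable (\<lambda>n. r n * (1 * noise n h \<omega>))" for h
    by (rule AE_summable_noise) auto
  moreover have "AE \<omega> in M. summable (\<lambda>n. r n * (vfield (state n \<omega>) $ h * noise n h \<omega>))" for h
    by (rule AE_summable_noise)
       (use vfield_state_bound drift_history Z_history in \<open>auto simp: vfield_state[abs_def]\<close>)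
  ultimately have "AE \<omega> in M. (\<forall>h. summable (\<lambda>n. r n * noise n h \<omega>)) \<and>
      (\<forall>h. summable (\<lambda>n. r n * (vfield (state n \<omega>) $ h * noise n h \<omega>)))"
    by (auto simp: AE_all_countable)
  with AE_space show ?thesis
    by eventually_elim (rule vfield_state_tendsto_0[OF G]; blast)
qed

end

section \<open>Almost sure synchronisation and the equation for the common limit\<close>

theorem theorem2p2:
  fixes M :: "'a measure"
    and \<alpha> \<beta> q :: real and f :: "real \<Rightarrow> real" and r :: "nat \<Rightarrow> real"
    and Z I :: "nat \<Rightarrow> 'n::finite \<Rightarrow> 'a \<Rightarrow> real"
  assumes model: "interacting_reinforced M \<alpha> \<beta> q f r Z I"
    and finite_diag: "finite {v \<in> (zeros_F \<alpha> \<beta> q f :: (real ^ 'n) set). \<exists>z. v = z *\<^sub>R 1}"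
    and primitive: "has_primitive_on f {0..1}"
    and at_most_one_zero: "\<And>c. c \<in> {- ((\<alpha> + \<beta>) / (1 - \<alpha> - \<beta>)) <..< 0} \<Longrightarrow>
           (\<exists>\<^sub>\<le>\<^sub>1 z. z \<in> {0..1} \<and> phi_tilde \<alpha> \<beta> f c z = 0)"
    and endpoint_if_uncoupled: "\<alpha> = 0 \<Longrightarrow> q = 1 \<Longrightarrow>
           (\<exists>\<^sub>\<le>\<^sub>1 z. z \<in> {0..1} \<and> phi_tilde \<alpha> \<beta> f (- ((\<alpha> + \<beta>) / (1 - \<alpha> - \<beta>))) z = 0)"
  shows "\<exists>Zinf. Zinf \<in> borel_measurable M \<and>
           (\<forall>\<omega>\<in>space M. Zinf \<omega> \<in> {0..1}) \<and>
           (AE \<omega> in M. (\<lambda>n. \<chi> h. Z n h \<omega>) \<longlonglongrightarrow> Zinf \<omega> *\<^sub>R (1 :: real ^ 'n)) \<and>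
           (AE \<omega> in M. f (Zinf \<omega>) - (1 - \<alpha>) / (1 - \<alpha> - \<beta>) * Zinf \<omega>
              + \<beta> * q / (1 - \<alpha> - \<beta>) = 0)"
proof -
  interpret interacting_reinforced M \<alpha> \<beta> q f r Z I by (rule model)
  have diagonal: "\<exists>c. a = c *\<^sub>R 1" if "a \<in> zeros_F \<alpha> \<beta> q f" for a :: "real ^ 'n"
    using \<alpha>_range(1) \<beta>_range(1) \<alpha>\<beta>_range q_range at_most_one_zero endpoint_if_uncoupled that
    by (rule zeros_F_diagonal)
  have zeros: "{a \<in> cbox 0 1. vfield a = 0} = zeros_F \<alpha> \<beta> q f"
    by (auto simp: zeros_F_def mem_box_cart)
  have fin: "finite {a \<in> cbox 0 1. vfield a = 0}"
    unfolding zeros using finite_diag diagonal by (auto elim: rev_finite_subset)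
  fix h0 :: 'n
  \<comment> \<open>On the convergence event all components share one limit, so any
    \<open>h0\<close> will do. Clamping keeps the values in the unit interval also where
    \<open>lim\<close> is arbitrary, and changes nothing on that event.\<close>
  define Zinf where "Zinf \<omega> = max 0 (min 1 (lim (\<lambda>n. Z n h0 \<omega>)))" for \<omega>
  have [measurable]: "Z n h \<in> borel_measurable M" for n h
    using Z_history[of n n h] by (auto intro: history_imp_measurable)
  have limit: "(\<lambda>n. state n \<omega>) \<longlonglongrightarrow> Zinf \<omega> *\<^sub>R 1 \<and> Zinf \<omega> *\<^sub>R (1 :: real ^ 'n) \<in> zeros_F \<alpha> \<beta> q f"
    if \<omega>: "\<omega> \<in> space M" and lim: "(\<lambda>n. vfield (state n \<omega>)) \<longlonglongrightarrow> 0" for \<omega>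
  proof -
    obtain a where a: "a \<in> cbox 0 1" "vfield a = 0" "(\<lambda>n. state n \<omega>) \<longlonglongrightarrow> a"
      using convergent_to_isolated_zero[OF compact_cbox continuous_on_F_field[OF f_continuous]
          state_in_cbox[OF \<omega>] lim fin state_steps_tendsto_0[OF \<omega>]] by blast
    then obtain c where c: "a = c *\<^sub>R 1" using diagonal[of a] zeros by blast
    have "(\<lambda>n. state n \<omega> $ h0) \<longlonglongrightarrow> a $ h0" using a(3) by (rule tendsto_vec_nth)
    hence "lim (\<lambda>n. Z n h0 \<omega>) = c" by (intro limI) (simp add: state_def c)
    moreover have "0 \<le> c" "c \<le> 1" using a(1) by (auto simp: c mem_box_cart)
    ultimately have "Zinf \<omega> = c" by (simp add: Zinf_def)
    moreover have "a \<in> zeros_F \<alpha> \<beta> q f" unfolding zeros[symmetric] using a by simp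
    ultimately show ?thesis using a(3) c by simp
  qed
  have ae: "AE \<omega> in M. (\<lambda>n. state n \<omega>) \<longlonglongrightarrow> Zinf \<omega> *\<^sub>R 1 \<and> Zinf \<omega> *\<^sub>R (1 :: real ^ 'n) \<in> zeros_F \<alpha> \<beta> q f"
    using AE_space AE_vfield_state_tendsto_0[OF primitive] by eventually_elim (rule limit)
  have equation: "f c - (1 - \<alpha>) / (1 - \<alpha> - \<beta>) * c + \<beta> * q / (1 - \<alpha> - \<beta>) = 0"
    if "c *\<^sub>R (1 :: real ^ 'n) \<in> zeros_F \<alpha> \<beta> q f" for c
  proof -
    \<comment> \<open>On the diagonal the mean equals \<open>c\<close>, so every component of the
      field gives this same scalar equation.\<close>
    have "\<alpha> * c + \<beta> * q + (1 - \<alpha> - \<beta>) * f c - c = 0"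
      using that by (auto simp: zeros_F_def F_field_def vec_eq_iff mean_def)
    hence "f c * (1 - \<alpha> - \<beta>) = (1 - \<alpha>) * c - \<beta> * q" by (simp add: algebra_simps)
    hence "f c = ((1 - \<alpha>) * c - \<beta> * q) / (1 - \<alpha> - \<beta>)"
      using \<alpha>\<beta>_range by (subst nonzero_eq_divide_eq) auto
    thus ?thesis by (simp only: diff_divide_distrib[of "(1 - \<alpha>) * c"]) simp
  qed
  show ?thesis
  proof (intro exI conjI)
    show "Zinf \<in> borel_measurable M" unfolding Zinf_def by measurable
    show "\<forall>\<omega>\<in>space M. Zinf \<omega> \<in> {0..1}" by (simp add: Zinf_def)
    show "AE \<omega> in M. (\<lambda>n. \<chi> h. Z n h \<omega>) \<longlonglongrightarrow> Zinf \<omega> *\<^sub>R (1 :: real ^ 'n)"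
      using ae by eventually_elim (simp add: state_def)
    show "AE \<omega> in M. f (Zinf \<omega>) - (1 - \<alpha>) / (1 - \<alpha> - \<beta>) * Zinf \<omega> + \<beta> * q / (1 - \<alpha> - \<beta>) = 0"
      using ae by eventually_elim (rule equation, simp)
  qed
qed

end
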